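(* Let $G$ be a finite abelian group of order $n\ge2$ with exponent $\kappa$, and let $\mathrm{Ord}(G,2)$ be the set of elements of $G$ of order at most $2$. (1) If $4\mid \kappa$, then $s(G,3)=\frac{n}{4}$. (2) If $\kappa$ is even but not divisible by $4$, then $s(G,3)=\frac14\big(n-|\mathrm{Ord}(G,2)|\big)$. (3) If $n$ is odd and has a prime divisor congruent to $5\pmod 6$, and $p$ is the smallest such prime divisor, then $s(G,3)=\left(1+\frac1p\right)\frac n6$. (4) If $n$ is odd and has no prime divisor congruent to $5\pmod 6$, then $\left\lfloor \frac{\kappa}{6}\right\rfloor\frac{n}{\kappa}\le s(G,3)\le \frac n6$.
   Context: $G$ is written additively; $\kappa$ is odd iff $n$ is odd. A subset $A=\{a_1,\dots,a_m\}$ (with $m\ge1$) of $G$ is called $t$-independent if whenever $\lambda_1a_1+\cdots+\lambda_ma_m=0$ for integers $\lambda_i$ with $\sum|\lambda_i|\le t$, we have all $\lambda_i=0$. $s(G,t)$ denotes the largest size of a $t$-independent subset of $G$ ($0$ if there is none). *)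

theory Defs
  imports "HOL-Algebra.Algebra" "HOL-Number_Theory.Number_Theory"
begin

text \<open>
  Abelian groups are \<open>comm_group\<close>s of \<open>HOL-Algebra\<close>, hence written multiplicatively: the
  integer combination \<open>\<lambda>\<^sub>1 a\<^sub>1 + \<dots> + \<lambda>\<^sub>m a\<^sub>m\<close> of the elements of a finite set \<open>A\<close> is the
  product of the powers \<open>a [^] l a\<close> over \<open>a \<in> A\<close>, and \<open>0\<close> is \<open>\<one>\<close>.
\<close>

definition group_exponent :: "('a, 'b) monoid_scheme \<Rightarrow> nat" where
  "group_exponent G = (LEAST k. 0 < k \<and> (\<forall>x\<in>carrier G. x [^]\<^bsub>G\<^esub> k = \<one>\<^bsub>G\<^esub>))"

text \<open>The guard excludes elements of infinite order, for which \<open>group.ord\<close> is \<open>0\<close>.\<close>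

definition Ord :: "('a, 'b) monoid_scheme \<Rightarrow> nat \<Rightarrow> 'a set" where
  "Ord G d = {x \<in> carrier G. 0 < group.ord G x \<and> group.ord G x \<le> d}"

definition t_independent :: "('a, 'b) monoid_scheme \<Rightarrow> nat \<Rightarrow> 'a set \<Rightarrow> bool" where
  "t_independent G t A \<longleftrightarrow>
     finite A \<and> A \<noteq> {} \<and> A \<subseteq> carrier G \<and>
     (\<forall>l :: 'a \<Rightarrow> int.
        (\<Sum>a\<in>A. \<bar>l a\<bar>) \<le> int t \<longrightarrow>
        (\<Otimes>\<^bsub>G\<^esub>a\<in>A. a [^]\<^bsub>G\<^esub> l a) = \<one>\<^bsub>G\<^esub> \<longrightarrow>
        (\<forall>a\<in>A. l a = 0))"

text \<open>
  Meaningful when the sizes of \<open>t\<close>-independent sets are bounded, in particular for finite \<open>G\<close>.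
  The inserted \<open>0\<close> is the value when there is no \<open>t\<close>-independent set.
\<close>

definition independence_size :: "('a, 'b) monoid_scheme \<Rightarrow> nat \<Rightarrow> nat" where
  "independence_size G t = Max (insert 0 (card ` {A. t_independent G t A}))"

end

theory Submission
  imports Defs
begin

text \<open>
  A set \<open>A\<close> is \<open>3\<close>-independent iff \<open>A\<close> and \<open>A\<inverse>\<close> are disjoint and \<open>S = A \<union> A\<inverse>\<close> is sum-free, so
  \<open>s(G,3)\<close> is half the largest size of a symmetric sum-free set without elements of order \<open>2\<close>.

  Lower bounds: \<open>G\<close> has a character onto \<open>\<int>/\<kappa>\<close>, hence onto \<open>\<int>/m\<close> for every divisor \<open>m\<close> of \<open>\<kappa>\<close>, and
  one pulls back a symmetric sum-free set of residues: the odd ones for \<open>m = 4\<close> and \<open>m = 2\<close> (in the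
  latter case removing the involutions), the middle third for \<open>m = p\<close> and \<open>m = \<kappa>\<close>.

  Upper bounds: \<open>S\<close> is disjoint from its translates \<open>s S\<close> with \<open>s \<in> S\<close>, which settles
  even \<open>\<kappa>\<close> (counting coset by coset of the involutions if \<open>4\<close> does not divide \<open>\<kappa>\<close>). For odd \<open>n\<close>,
  Kneser's theorem applied to \<open>S S\<close> gives \<open>|S| \<le> q n / m\<close> for a divisor \<open>m\<close> of \<open>n\<close> and some
  \<open>q\<close> with \<open>3 q \<le> m + 1\<close>; this exceeds \<open>n / 3\<close> only if \<open>m \<equiv> 2\<close> modulo \<open>3\<close>, and then \<open>m\<close> has a prime
  factor congruent to \<open>5\<close> modulo \<open>6\<close>.
\<close>

section \<open>Kneser's theorem\<close>

locale finite_comm_group = comm_group +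
  assumes finite_carrier [simp]: "finite (carrier G)"

context finite_comm_group
begin

section \<open>Subgroups, stabilizers and unions of cosets\<close>

lemma finite_subset_carrier: "A \<subseteq> carrier G \<Longrightarrow> finite A"
  using finite_carrier finite_subset by blast

text \<open>Finiteness supplies the inverses: \<open>x [^] (order G - 1)\<close> inverts
  \<open>x\<close>.\<close>

lemma subgroup_of_closed:
  assumes "H \<subseteq> carrier G" "\<one> \<in> H" and closed: "\<And>x y. x \<in> H \<Longrightarrow> y \<in> H \<Longrightarrow> x \<otimes> y \<in> H"
  shows "subgroup H G"
proof (rule subgroupI)
  fix x assume x: "x \<in> H"
  then have xc: "x \<in> carrier G" using assms by blast
  have pow: "x [^] k \<in> H" for k :: nat
    by (induction k) (use assms x in auto)
  have "order G > 0" by (simp add: order_gt_0_iff_finite)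
  then have "x \<otimes> x [^] (order G - 1) = \<one>"
    using xc pow_order_eq_1[OF xc] nat_pow_Suc2[OF xc, of "order G - 1"] by simp
  then have "inv x = x [^] (order G - 1)"
    using xc by (metis inv_equality m_comm nat_pow_closed)
  then show "inv x \<in> H" using pow by simp
qed (use assms in auto)

text \<open>For \<open>C\<close> in the carrier this is the usual stabilizer \<open>g C = C\<close>,
  because translation is injective and \<open>C\<close> is finite.\<close>

definition stabilizer_of :: "'a set \<Rightarrow> 'a set" where
  "stabilizer_of C = {g \<in> carrier G. \<forall>x\<in>C. g \<otimes> x \<in> C}"

lemma subgroup_stabilizer_of: "C \<subseteq> carrier G \<Longrightarrow> subgroup (stabilizer_of C) G"
  by (rule subgroup_of_closed) (auto simp: stabilizer_of_def m_assoc subset_iff)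

text \<open>\<open>C\<close> is a union of cosets of \<open>H\<close>. Here \<open>H\<close> may be
  smaller than the full stabilizer; passing to \<open>H1 \<inter> H2\<close> for unions relies on
  that.\<close>

definition periodic :: "'a set \<Rightarrow> 'a set \<Rightarrow> bool" where
  "periodic H C \<longleftrightarrow> subgroup H G \<and> C \<subseteq> carrier G \<and> (\<forall>h\<in>H. \<forall>x\<in>C. h \<otimes> x \<in> C)"

lemma periodicD:
  assumes "periodic H C"
  shows "subgroup H G" "C \<subseteq> carrier G" "H \<subseteq> carrier G"
    "h \<in> H \<Longrightarrow> x \<in> C \<Longrightarrow> h \<otimes> x \<in> C"
  using assms by (auto simp: periodic_def dest: subgroup.subset)

lemma periodic_mult_iff:
  assumes "periodic H C" "h \<in> H" "x \<in> carrier G"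
  shows "h \<otimes> x \<in> C \<longleftrightarrow> x \<in> C"
proof
  assume a: "h \<otimes> x \<in> C"
  have "inv h \<in> H" using assms by (meson periodicD(1) subgroup.m_inv_closed)
  then have "inv h \<otimes> (h \<otimes> x) \<in> C" using a assms periodicD(4) by blast
  moreover have "h \<in> carrier G" using assms periodicD(3) by blast
  ultimately show "x \<in> C" using assms by (simp add: m_assoc[symmetric])
qed (use assms periodicD(4) in blast)

lemma periodic_stabilizer_of: "C \<subseteq> carrier G \<Longrightarrow> periodic (stabilizer_of C) C"
  unfolding periodic_def using subgroup_stabilizer_of by (auto simp: stabilizer_of_def)

section \<open>Counting in cosets and in differences of periodic sets\<close>

lemma card_translate:
  "x \<in> carrier G \<Longrightarrow> A \<subseteq> carrier G \<Longrightarrow> card ((\<otimes>) x ` A) = card A"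
  by (intro card_image inj_on_subset[OF inj_on_cmult]) auto

lemma card_translate_le:
  assumes "x \<in> carrier G" "A \<subseteq> carrier G" "B \<subseteq> carrier G" "\<And>a. a \<in> A \<Longrightarrow> x \<otimes> a \<in> B"
  shows "card A \<le> card B"
  using card_mono[of B "(\<otimes>) x ` A"] assms card_translate[of x A] finite_subset_carrier by auto

lemma card_r_coset: "H \<subseteq> carrier G \<Longrightarrow> x \<in> carrier G \<Longrightarrow> card (H #> x) = card H"
  using card_rcosets_equal[OF rcosetsI] by simp

lemma mem_r_coset: "y \<in> H #> x \<longleftrightarrow> (\<exists>h\<in>H. y = h \<otimes> x)"
  by (auto simp: r_coset_def)

lemma periodic_r_coset_subset: "periodic H C \<Longrightarrow> x \<in> C \<Longrightarrow> H #> x \<subseteq> C"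
  by (auto simp: mem_r_coset dest: periodicD(4))

lemma periodic_r_coset_disjoint: 
  "periodic H C \<Longrightarrow> x \<in> carrier G \<Longrightarrow> x \<notin> C \<Longrightarrow> (H #> x) \<inter> C = {}"
  using periodic_mult_iff by (auto simp: mem_r_coset)

text \<open>By \<open>sep\<close>, \<open>D2 - D1\<close> misses the coset of \<open>H1 H2\<close>
  through \<open>u\<close>. Either \<open>H2 u\<close> stays in \<open>D1\<close>, hence in
  \<open>D1 - D2\<close>; or some \<open>h2 u\<close> leaves \<open>D1\<close>, and then a point
  \<open>h1 u\<close> in \<open>D2\<close> would put \<open>h1 h2 u\<close> in
  \<open>D2 - D1\<close>, so \<open>H1 u\<close> lies in \<open>D1 - D2\<close>.\<close>

lemma card_periodic_Diff_cases:
  assumes D1: "periodic H1 D1" and D2: "periodic H2 D2" and u: "u \<in> D1 - D2"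
    and sep: "\<And>h1 h2. h1 \<in> H1 \<Longrightarrow> h2 \<in> H2 \<Longrightarrow> h1 \<otimes> (h2 \<otimes> u) \<notin> D2 - D1"
  shows "card H1 \<le> card (D1 - D2) \<or> card H2 \<le> card (D1 - D2)"
proof -
  note [simp] = periodicD(2,3)[OF D1, THEN subsetD] periodicD(2,3)[OF D2, THEN subsetD]
  have uc: "u \<in> carrier G" and fin: "finite (D1 - D2)"
    using u periodicD(2)[OF D1] finite_subset_carrier by auto
  have "H2 #> u \<subseteq> D1 \<or> (\<exists>h2\<in>H2. h2 \<otimes> u \<notin> D1)"
    by (auto simp: mem_r_coset)
  then consider "H2 #> u \<subseteq> D1" | h2 where "h2 \<in> H2" "h2 \<otimes> u \<notin> D1"
    by auto
  then show ?thesis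
  proof cases
    case 1
    then have "H2 #> u \<subseteq> D1 - D2" using periodic_r_coset_disjoint[OF D2 uc] u by blast
    then show ?thesis using card_mono[OF fin] card_r_coset periodicD(3)[OF D2] uc by metis
  next
    case 2
    have "h1 \<otimes> u \<notin> D2" if h1: "h1 \<in> H1" for h1
    proof
      assume "h1 \<otimes> u \<in> D2"
      then have "h2 \<otimes> (h1 \<otimes> u) \<in> D2" using 2 periodicD(4)[OF D2] by simp
      then have "h1 \<otimes> (h2 \<otimes> u) \<in> D2" using h1 2 uc by (simp add: m_lcomm)
      moreover have "h1 \<otimes> (h2 \<otimes> u) \<notin> D1"
        using periodic_mult_iff[OF D1 h1, of "h2 \<otimes> u"] 2 uc by simp
      ultimately show False using sep h1 2 by blast
    qed
    then have "H1 #> u \<subseteq> D1 - D2"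
      using periodic_r_coset_subset[OF D1, of u] u by (auto simp: mem_r_coset)
    then show ?thesis using card_mono[OF fin] card_r_coset periodicD(3)[OF D1] uc by metis
  qed
qed

lemma mult_cancel_shuffle:
  assumes "k \<in> carrier G" "h \<in> carrier G" "g \<in> carrier G" "u \<in> carrier G"
  shows "g \<otimes> (k \<otimes> u) = k \<otimes> inv h \<otimes> (h \<otimes> (g \<otimes> u))"
proof -
  have "inv h \<otimes> (h \<otimes> (g \<otimes> u)) = g \<otimes> u"
    using assms by (simp add: m_assoc[symmetric])
  then have "k \<otimes> inv h \<otimes> (h \<otimes> (g \<otimes> u)) = k \<otimes> (g \<otimes> u)"
    using assms m_assoc[of k "inv h" "h \<otimes> (g \<otimes> u)"] by simp
  then show ?thesis using assms m_lcomm[of g k u] by simp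
qed

text \<open>The part of \<open>H1 v\<close> inside \<open>D2\<close> and the part of
  \<open>H2 v\<close> outside \<open>D1\<close> both lie in \<open>D2 - D1\<close>, and they meet
  only inside \<open>(H1 \<inter> H2) v\<close>.\<close>

lemma card_periodic_Diff_coset:
  assumes D1: "periodic H1 D1" and D2: "periodic H2 D2" and v: "v \<in> D2 - D1"
  shows "card ((H1 #> v) \<inter> D2) + card ((H2 #> v) - D1) \<le> card (D2 - D1) + card (H1 \<inter> H2)"
proof -
  note [simp] = periodicD(2,3)[OF D1, THEN subsetD] periodicD(2,3)[OF D2, THEN subsetD]
  let ?X = "(H1 #> v) \<inter> D2" and ?Y = "(H2 #> v) - D1"
  have vc: "v \<in> carrier G" using v by auto
  have sub: "?X \<union> ?Y \<subseteq> D2 - D1"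
    using periodic_r_coset_disjoint[OF D1 vc] periodic_r_coset_subset[OF D2, of v] v by blast
  have fin: "finite (D2 - D1)" using finite_subset_carrier periodicD(2)[OF D2] by blast
  have cap: "?X \<inter> ?Y \<subseteq> (H1 \<inter> H2) #> v"
    using vc by (auto simp: mem_r_coset)
  have "card ?X + card ?Y = card (?X \<union> ?Y) + card (?X \<inter> ?Y)"
    by (rule card_Un_Int) (use fin sub finite_subset in blast)+
  also have "card (?X \<union> ?Y) \<le> card (D2 - D1)" using card_mono[OF fin sub] .
  also have "card (?X \<inter> ?Y) \<le> card ((H1 \<inter> H2) #> v)"
    by (rule card_mono[OF _ cap])
      (metis finite_subset_carrier r_coset_subset_G vc le_infI1 periodicD(3)[OF D1])
  also have "card ((H1 \<inter> H2) #> v) = card (H1 \<inter> H2)"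
    by (rule card_r_coset) (use vc in auto)
  finally show ?thesis by simp
qed

text \<open>
  When \<open>u\<close> and \<open>v\<close> lie in the same coset of \<open>H1 H2\<close>, that coset is a grid in which \<open>D1\<close> is a
  union of rows and \<open>D2\<close> a union of columns.
\<close>

lemma card_periodic_Diff:
  assumes D1: "periodic H1 D1" and D2: "periodic H2 D2"
    and "\<not> D1 \<subseteq> D2" "\<not> D2 \<subseteq> D1"
  shows "card H2 \<le> card (D1 - D2) + card (H1 \<inter> H2) \<or> card H1 \<le> card (D2 - D1) + card (H1 \<inter> H2)"
proof -
  note car [simp] = periodicD(2,3)[OF D1, THEN subsetD] periodicD(2,3)[OF D2, THEN subsetD]
  show ?thesis
  proof (cases "\<exists>u\<in>D1 - D2. \<exists>h1\<in>H1. \<exists>h2\<in>H2. h1 \<otimes> (h2 \<otimes> u) \<in> D2 - D1")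
    case True
    then obtain u v h1 h2 where u: "u \<in> D1 - D2" and h: "h1 \<in> H1" "h2 \<in> H2"
      and v: "v \<in> D2 - D1" "v = h1 \<otimes> (h2 \<otimes> u)" by blast
    have uc: "u \<in> carrier G" and vc: "v \<in> carrier G" using u v(1) by auto
    have sub: "H1 #> x \<subseteq> carrier G" "H2 #> x \<subseteq> carrier G" if "x \<in> carrier G" for x
      using that periodicD(3)[OF D1] periodicD(3)[OF D2] r_coset_subset_G by blast+
    have mult: "k \<otimes> h \<in> H" if "subgroup H G" "k \<in> H" "h \<in> H" for H k h
      using that by (simp add: subgroup.m_closed)
    \<comment> \<open>Translation by \<open>h2\<close> takes the row of \<open>u\<close> to the row
      of \<open>v\<close> and preserves \<open>D2\<close>; translation by \<open>h1\<close> does the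
      same for columns and the complement of \<open>D1\<close>.\<close>
    have "card ((H1 #> u) \<inter> D2) \<le> card ((H1 #> v) \<inter> D2)"
    proof (rule card_translate_le[of h2])
      fix a assume "a \<in> (H1 #> u) \<inter> D2"
      then obtain k where k: "k \<in> H1" "a = k \<otimes> u" "a \<in> D2" by (auto simp: mem_r_coset)
      have e: "h2 \<otimes> a = (k \<otimes> inv h1) \<otimes> v"
        using k(1,2) h v(2) uc mult_cancel_shuffle[of k h1 h2 u] by simp
      have "k \<otimes> inv h1 \<in> H1"
        using mult[OF periodicD(1)[OF D1] k(1)] h periodicD(1)[OF D1]
        by (simp add: subgroup.m_inv_closed)
      then show "h2 \<otimes> a \<in> (H1 #> v) \<inter> D2"
        using e periodicD(4)[OF D2 h(2) k(3)] by (auto simp: mem_r_coset)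
    qed (use h uc vc sub in auto)
    moreover have "card ((H2 #> u) - D1) \<le> card ((H2 #> v) - D1)"
    proof (rule card_translate_le[of h1])
      fix a assume "a \<in> (H2 #> u) - D1"
      then obtain k where k: "k \<in> H2" "a = k \<otimes> u" "a \<notin> D1" by (auto simp: mem_r_coset)
      have e: "h1 \<otimes> a = (k \<otimes> inv h2) \<otimes> v"
        using k(1,2) h v(2) uc mult_cancel_shuffle[of k h2 h1 u] m_lcomm[of h1 h2 u] by simp
      have "k \<otimes> inv h2 \<in> H2"
        using mult[OF periodicD(1)[OF D2] k(1)] h periodicD(1)[OF D2]
        by (simp add: subgroup.m_inv_closed)
      moreover have "h1 \<otimes> a \<notin> D1"
        using periodic_mult_iff[OF D1 h(1)] k uc by simp
      ultimately show "h1 \<otimes> a \<in> (H2 #> v) - D1"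
        using e by (auto simp: mem_r_coset)
    qed (use h uc vc sub in auto)
    moreover have "card H1 = card ((H1 #> u) \<inter> D2) + card ((H1 #> u) - D2)"
      using card_r_coset[OF periodicD(3)[OF D1] uc] card_Int_Diff[of "H1 #> u" D2]
        finite_subset_carrier sub uc by simp
    moreover have "card H2 = card ((H2 #> u) \<inter> D1) + card ((H2 #> u) - D1)"
      using card_r_coset[OF periodicD(3)[OF D2] uc] card_Int_Diff[of "H2 #> u" D1]
        finite_subset_carrier sub uc by simp
    \<comment> \<open>Adding everything gives
      \<open>|H1| + |H2| \<le> |D1 - D2| + |D2 - D1| + 2 |H1 \<inter> H2|\<close>, which is
      impossible if both alternatives fail.\<close>
    moreover note card_periodic_Diff_coset[OF D1 D2 v(1)] card_periodic_Diff_coset[OF D2 D1 u]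
    ultimately show ?thesis by (simp add: Int_commute) linarith
  next
    case False
    obtain u v where u: "u \<in> D1 - D2" and v: "v \<in> D2 - D1" using assms by blast
    have "card H1 \<le> card (D1 - D2) \<or> card H2 \<le> card (D1 - D2)"
      by (rule card_periodic_Diff_cases[OF D1 D2 u]) (use u False in blast)
    moreover have "card H2 \<le> card (D2 - D1) \<or> card H1 \<le> card (D2 - D1)"
    proof (rule card_periodic_Diff_cases[OF D2 D1 v])
      fix h2 h1 assume h: "h2 \<in> H2" "h1 \<in> H1"
      define u' where "u' = h2 \<otimes> (h1 \<otimes> v)"
      have i: "inv h1 \<in> H1" "inv h2 \<in> H2"
        using h periodicD(1)[OF D1] periodicD(1)[OF D2] by (auto simp: subgroup.m_inv_closed)
      have "inv h1 \<otimes> (inv h2 \<otimes> u') = v"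
        using h v by (simp add: u'_def m_assoc[symmetric])
      then show "h2 \<otimes> (h1 \<otimes> v) \<notin> D1 - D2"
        using False i v unfolding u'_def by metis
    qed
    \<comment> \<open>If both alternatives of the goal failed, these facts would leave
      \<open>|H1| \<le> |D1 - D2| < |H2|\<close> and
      \<open>|H2| \<le> |D2 - D1| < |H1|\<close>.\<close>
    ultimately show ?thesis by linarith
  qed
qed

text \<open>
  Kneser's theorem holds because \<open>A B\<close> is a union of subsets that are large and periodic for
  \<open>s = |A| + |B|\<close>, and such sets are closed under unions.
\<close>

definition large_periodic :: "nat \<Rightarrow> 'a set \<Rightarrow> bool" where
  "large_periodic s C \<longleftrightarrow> (\<exists>H. periodic H C \<and> s \<le> card C + card H)"

text \<open>The union is only known to have the period \<open>H1 \<inter> H2\<close>, but by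
  \<open>card_periodic_Diff\<close> the points gained make up for the loss from \<open>H1\<close> or
  from \<open>H2\<close>.\<close>

lemma large_periodic_Un:
  assumes "large_periodic s D1" "large_periodic s D2"
  shows "large_periodic s (D1 \<union> D2)"
proof -
  obtain H1 H2 where D1: "periodic H1 D1" "s \<le> card D1 + card H1"
    and D2: "periodic H2 D2" "s \<le> card D2 + card H2"
    using assms unfolding large_periodic_def by blast
  show ?thesis
  proof (cases "D1 \<subseteq> D2 \<or> D2 \<subseteq> D1")
    case True
    then show ?thesis using assms by (auto simp: sup.absorb1 sup.absorb2)
  next
    case False
    have fin: "finite D1" "finite D2"
      using D1 D2 periodicD(2) finite_subset_carrier by blast+
    have "card (D1 \<union> D2) = card D1 + card (D2 - D1)" "card (D1 \<union> D2) = card D2 + card (D1 - D2)"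
      using fin card_Un_disjoint[of D1 "D2 - D1"] card_Un_disjoint[of D2 "D1 - D2"]
      by (simp_all add: Un_commute)
    moreover have "periodic (H1 \<inter> H2) (D1 \<union> D2)"
      using D1(1) D2(1) subgroups_Inter_pair unfolding periodic_def by auto
    moreover have "s \<le> card (D1 \<union> D2) + card (H1 \<inter> H2)"
      using card_periodic_Diff[OF D1(1) D2(1)] False D1(2) D2(2) calculation(1,2) by linarith
    ultimately show ?thesis
      unfolding large_periodic_def by blast
  qed
qed

text \<open>Induction on \<open>B\<close> by the Dyson transform \<open>A \<union> e b\<inverse> B\<close>, \<open>B \<inter> b e\<inverse> A\<close> with \<open>e \<in> A\<close>.\<close>

lemma large_periodic_subset_set_mult:
  assumes "A \<subseteq> carrier G" "B \<subseteq> carrier G" "a \<in> A" "b \<in> B"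
  shows "\<exists>C. large_periodic (card A + card B) C \<and> a \<otimes> b \<in> C \<and> C \<subseteq> A <#> B"
  using assms
proof (induction "card B" arbitrary: A B rule: less_induct)
  case less
  have fin: "finite A" "finite B" using less.prems finite_subset_carrier by auto
  have bc: "b \<in> carrier G" using less.prems by blast
  show ?case
  proof (cases "\<exists>e\<in>A. \<exists>y\<in>B. e \<otimes> inv b \<otimes> y \<notin> A")
    case True
    then obtain e y where e: "e \<in> A" "y \<in> B" "e \<otimes> inv b \<otimes> y \<notin> A" by blast
    have ec: "e \<in> carrier G" using e less.prems by blast
    define g where "g = e \<otimes> inv b"
    have gc: "g \<in> carrier G" using ec bc by (simp add: g_def)
    define A' where "A' = A \<union> (\<otimes>) g ` B"
    define B' where "B' = B \<inter> {y. g \<otimes> y \<in> A}"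
    \<comment> \<open>\<open>b\<close> stays in \<open>B'\<close> because \<open>g b = e\<close>,
      while \<open>y\<close> drops out.\<close>
    have "card B' < card B"
      using e fin by (intro psubset_card_mono) (auto simp: B'_def g_def)
    moreover have "A' \<subseteq> carrier G" "B' \<subseteq> carrier G" "a \<in> A'" "b \<in> B'"
      using less.prems gc e ec bc by (auto simp: A'_def B'_def g_def m_assoc)
    ultimately obtain C where C: "large_periodic (card A' + card B') C" "a \<otimes> b \<in> C" "C \<subseteq> A' <#> B'"
      using less.hyps by meson
    have "A' <#> B' \<subseteq> A <#> B"
    proof
      fix z assume "z \<in> A' <#> B'"
      then obtain x w where z: "x \<in> A'" "w \<in> B'" "z = x \<otimes> w" by (auto simp: set_mult_def)
      show "z \<in> A <#> B"
      proof (cases "x \<in> A")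
        case True
        then show ?thesis using z by (auto simp: set_mult_def B'_def)
      next
        case False
        then obtain v where v: "v \<in> B" "x = g \<otimes> v" using z by (auto simp: A'_def)
        have "v \<in> carrier G" "w \<in> carrier G" using v z less.prems by (auto simp: B'_def)
        \<comment> \<open>The factor \<open>g\<close> moves from \<open>v\<close> to
          \<open>w\<close>: by the definition of \<open>B'\<close>, \<open>g w\<close> lies in
          \<open>A\<close>.\<close>
        then have "z = (g \<otimes> w) \<otimes> v"
          using z v gc by (simp add: m_ac)
        then show ?thesis using v z by (auto simp: set_mult_def B'_def)
      qed
    qed
    moreover have "card A' + card B' = card A + card B"
    proof -
      have "A \<inter> (\<otimes>) g ` B = (\<otimes>) g ` B'" by (auto simp: B'_def)
      then have "card (A \<inter> (\<otimes>) g ` B) = card B'"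
        using card_translate[OF gc, of B'] \<open>B' \<subseteq> carrier G\<close> by simp
      then show ?thesis
        using card_Un_Int[of A "(\<otimes>) g ` B"] fin card_translate[OF gc, of B] less.prems
        by (simp add: A'_def)
    qed
    ultimately show ?thesis using C by (intro exI[of _ C]) auto
  next
    case False
    \<comment> \<open>No transform shrinks \<open>B\<close>, so \<open>inv b B\<close> stabilizes
      \<open>A\<close>; hence \<open>b A\<close> has a period of size at least
      \<open>|B|\<close>.\<close>
    define C where "C = (\<otimes>) b ` A"
    have "card C = card A" using card_translate bc less.prems C_def by blast
    have sub: "(\<otimes>) (inv b) ` B \<subseteq> stabilizer_of A"
    proof (clarsimp simp: stabilizer_of_def)
      fix y assume y: "y \<in> B"
      then have yc: "y \<in> carrier G" using less.prems by blast
      have "inv b \<otimes> y \<otimes> x \<in> A" if x: "x \<in> A" for x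
      proof -
        have "x \<otimes> inv b \<otimes> y = inv b \<otimes> y \<otimes> x"
          using x less.prems bc yc by (auto simp: m_ac)
        then show ?thesis using False x y by metis
      qed
      then show "inv b \<otimes> y \<in> carrier G \<and> (\<forall>x\<in>A. inv b \<otimes> y \<otimes> x \<in> A)"
        using bc yc by simp
    qed
    have st: "stabilizer_of A \<subseteq> carrier G" by (auto simp: stabilizer_of_def)
    have "card B \<le> card (stabilizer_of A)"
      using card_mono[OF _ sub] finite_subset_carrier[OF st] card_translate[of "inv b" B] bc less.prems
      by simp
    moreover have "periodic (stabilizer_of A) C"
      unfolding periodic_def
    proof (intro conjI ballI)
      show "subgroup (stabilizer_of A) G" using subgroup_stabilizer_of less.prems by blast
      show "C \<subseteq> carrier G" using bc less.prems by (auto simp: C_def)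
      fix h x assume "h \<in> stabilizer_of A" "x \<in> C"
      then show "h \<otimes> x \<in> C"
        using less.prems bc by (auto simp: C_def stabilizer_of_def m_lcomm subset_iff)
    qed
    ultimately have "large_periodic (card A + card B) C"
      unfolding large_periodic_def using \<open>card C = card A\<close> by force
    moreover have "a \<otimes> b \<in> C" "C \<subseteq> A <#> B"
      using less.prems bc by (auto simp: C_def set_mult_def m_comm subset_iff)
    ultimately show ?thesis by blast
  qed
qed

text \<open>The usual form has \<open>|A H| + |B H|\<close> in place of \<open>|A| + |B|\<close>.
  This form suffices, since it is applied to a set that already absorbs the stabilizer of its
  square.\<close>

theorem Kneser_weak:
  assumes "A \<subseteq> carrier G" "B \<subseteq> carrier G" "A \<noteq> {}" "B \<noteq> {}"
  obtains H where "periodic H (A <#> B)" "card A + card B \<le> card (A <#> B) + card H"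
proof -
  define s where "s = card A + card B"
  have sub: "A <#> B \<subseteq> carrier G" using assms setmult_subset_G by blast
  have "\<exists>C. large_periodic s C \<and> z \<in> C \<and> C \<subseteq> A <#> B" if "z \<in> A <#> B" for z
    using that large_periodic_subset_set_mult assms unfolding s_def set_mult_def by blast
  then obtain C where C: "\<And>z. z \<in> A <#> B \<Longrightarrow> large_periodic s (C z) \<and> z \<in> C z \<and> C z \<subseteq> A <#> B"
    by metis
  \<comment> \<open>The induction starts at singletons, as the empty set need not be large.\<close>
  have "large_periodic s (\<Union> (C ` Z))" if "finite Z" "Z \<noteq> {}" "Z \<subseteq> A <#> B" for Z
    using that by (induction Z rule: finite_ne_induct) (use C large_periodic_Un in auto)
  moreover have "A <#> B \<noteq> {}" using assms by (auto simp: set_mult_def)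
  moreover have "\<Union> (C ` (A <#> B)) = A <#> B" using C by blast
  ultimately have "large_periodic s (A <#> B)"
    using finite_subset_carrier[OF sub] by (metis subset_refl)
  then show thesis using that unfolding large_periodic_def s_def by blast
qed

section \<open>Symmetric sum-free sets and 3-independence\<close>

text \<open>Given symmetry, the last clause says that no three elements multiply to
  \<open>\<one>\<close>; the clause \<open>inv x \<noteq> x\<close> keeps out the elements of order
  at most \<open>2\<close>.\<close>

definition symmetric_sum_free :: "'a set \<Rightarrow> bool" where
  "symmetric_sum_free S \<longleftrightarrow> S \<subseteq> carrier G \<and> (\<forall>x\<in>S. inv x \<in> S \<and> inv x \<noteq> x) \<and>
     (\<forall>x\<in>S. \<forall>y\<in>S. x \<otimes> y \<notin> S)"

lemma symmetric_sum_freeD: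
  assumes "symmetric_sum_free S"
  shows "S \<subseteq> carrier G" "x \<in> S \<Longrightarrow> inv x \<in> S" "x \<in> S \<Longrightarrow> inv x \<noteq> x"
    "x \<in> S \<Longrightarrow> y \<in> S \<Longrightarrow> x \<otimes> y \<notin> S"
  using assms by (auto simp: symmetric_sum_free_def)

text \<open>A combination becomes a word in which \<open>a\<close> or its inverse, according to the
  sign of \<open>l a\<close>, occurs \<open>|l a|\<close> times. Its length is the weight, so weight
  at most \<open>3\<close> becomes a case analysis on short lists.\<close>

lemma finprod_int_pow_eq_foldr:
  assumes "finite A" "A \<subseteq> carrier G"
  shows "\<exists>xs. set xs \<subseteq> {a [^] sgn (l a) |a. a \<in> A \<and> l a \<noteq> (0::int)} \<and>
    int (length xs) = (\<Sum>a\<in>A. \<bar>l a\<bar>) \<and> foldr (\<otimes>) xs \<one> = (\<Otimes>a\<in>A. a [^] l a)"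
  using assms
proof (induction A)
  case empty
  then show ?case by (intro exI[of _ "[]"]) auto
next
  case (insert a A)
  then obtain xs where xs: "set xs \<subseteq> {a [^] sgn (l a) |a. a \<in> A \<and> l a \<noteq> 0}"
      "int (length xs) = (\<Sum>a\<in>A. \<bar>l a\<bar>)" "foldr (\<otimes>) xs \<one> = (\<Otimes>a\<in>A. a [^] l a)"
    by auto
  have a: "a \<in> carrier G" "A \<subseteq> carrier G" using insert.prems by auto
  define P where "P = (\<Otimes>a\<in>A. a [^] l a)"
  have P: "P \<in> carrier G" unfolding P_def using a by (intro finprod_closed) auto
  define ys where "ys = replicate (nat \<bar>l a\<bar>) (a [^] sgn (l a)) @ xs"
  have "foldr (\<otimes>) (replicate k (a [^] sgn (l a))) P = (a [^] sgn (l a)) [^] k \<otimes> P" for k :: nat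
    using a P by (induction k) (auto simp: m_ac)
  moreover have "(a [^] sgn (l a)) [^] nat \<bar>l a\<bar> = a [^] l a"
  proof -
    have "(a [^] sgn (l a)) [^] int (nat \<bar>l a\<bar>) = a [^] (sgn (l a) * int (nat \<bar>l a\<bar>))"
      using a by (simp only: int_pow_pow)
    also have "sgn (l a) * int (nat \<bar>l a\<bar>) = l a" by (simp add: sgn_mult_abs)
    finally show ?thesis by (simp only: int_pow_int)
  qed
  ultimately have "foldr (\<otimes>) ys \<one> = a [^] l a \<otimes> P"
    using xs(3) by (simp add: ys_def P_def)
  also have "\<dots> = (\<Otimes>a\<in>insert a A. a [^] l a)"
    unfolding P_def by (rule finprod_insert[symmetric]) (use insert.hyps a in auto)
  finally have "foldr (\<otimes>) ys \<one> = (\<Otimes>a\<in>insert a A. a [^] l a)" .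
  moreover have "set ys \<subseteq> {b [^] sgn (l b) |b. b \<in> insert a A \<and> l b \<noteq> 0}"
    using xs(1) by (cases "l a = 0") (auto simp: ys_def)
  moreover have "int (length ys) = (\<Sum>a\<in>insert a A. \<bar>l a\<bar>)"
    using xs(2) insert.hyps by (simp add: ys_def)
  ultimately show ?case by blast
qed

lemma int_pow_uminus_1: "x \<in> carrier G \<Longrightarrow> x [^] (- 1 :: int) = inv x"
  by (simp add: int_pow_neg)

text \<open>
  Every relation of weight at most \<open>3\<close> among the elements of \<open>A\<close> is a product of at most three
  elements of \<open>A \<union> A\<inverse>\<close>, no two of which are inverse to each other.
\<close>

lemma t_independent_3I:
  assumes S: "symmetric_sum_free S" and A: "A \<subseteq> S" "A \<noteq> {}" "\<And>a. a \<in> A \<Longrightarrow> inv a \<notin> A"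
  shows "t_independent G 3 A"
  unfolding t_independent_def
proof (intro conjI allI impI)
  have Ac: "A \<subseteq> carrier G" using A symmetric_sum_freeD(1)[OF S] by blast
  then show fin: "finite A" "A \<subseteq> carrier G" by (auto intro: finite_subset_carrier)
  show "A \<noteq> {}" by fact
  fix l :: "'a \<Rightarrow> int"
  assume l: "(\<Sum>a\<in>A. \<bar>l a\<bar>) \<le> int 3" and eq: "(\<Otimes>a\<in>A. a [^] l a) = \<one>"
  obtain xs where xs: "set xs \<subseteq> {a [^] sgn (l a) |a. a \<in> A \<and> l a \<noteq> 0}"
      "int (length xs) = (\<Sum>a\<in>A. \<bar>l a\<bar>)" "foldr (\<otimes>) xs \<one> = \<one>"
    using finprod_int_pow_eq_foldr[OF fin, of l] unfolding eq by blast
  have sgn: "sgn k = 1 \<or> sgn k = - 1" if "k \<noteq> 0" for k :: int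
    using that by (auto simp: sgn_if)
  have xS: "x \<in> S" if x: "x \<in> set xs" for x
  proof -
    obtain a where a: "a \<in> A" "x = a [^] sgn (l a)" "l a \<noteq> 0" using x xs(1) by blast
    then have "a \<in> S" "inv a \<in> S" "a \<in> carrier G" using A S symmetric_sum_freeD by blast+
    then show ?thesis using sgn[OF a(3)] a(2) by (auto simp: int_pow_uminus_1)
  qed
  then have xc: "x \<in> carrier G" if "x \<in> set xs" for x
    using that symmetric_sum_freeD(1)[OF S] by blast
  \<comment> \<open>Letters from one \<open>a\<close> carry one sign, so an inverse pair among them
    would be a self-inverse element of \<open>S\<close>; letters from distinct \<open>a\<close> and
    \<open>b\<close> would force \<open>a = b\<close> or \<open>inv a = b\<close>.\<close>
  have noinv: "inv x \<noteq> y" if xy: "x \<in> set xs" "y \<in> set xs" for x y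
  proof
    assume i: "inv x = y"
    obtain a where a: "a \<in> A" "x = a [^] sgn (l a)" "l a \<noteq> 0" using xy(1) xs(1) by blast
    obtain b where b: "b \<in> A" "y = b [^] sgn (l b)" "l b \<noteq> 0" using xy(2) xs(1) by blast
    have c: "a \<in> carrier G" "b \<in> carrier G" using a b Ac by auto
    show False
    proof (cases "a = b")
      case True
      then show False using a b i symmetric_sum_freeD(3)[OF S xS[OF xy(1)]] by simp
    next
      case False
      then show False
        using sgn[OF a(3)] sgn[OF b(3)] a(1,2) b(1,2) i A(3) c
        by (auto simp: int_pow_uminus_1)
    qed
  qed
  have "length xs \<le> 3" using l xs(2) by simp
  then consider "xs = []" | x where "xs = [x]" | x y where "xs = [x, y]"
    | x y z where "xs = [x, y, z]"
    by (auto simp: numeral_3_eq_3 le_Suc_eq length_Suc_conv)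
  \<comment> \<open>Lengths \<open>1\<close> and \<open>2\<close> give an inverse pair of letters,
    \<open>\<one>\<close> being inverse to itself; length \<open>3\<close> gives
    \<open>inv z = x y\<close>, against sum-freeness.\<close>
  then have "xs = []"
  proof cases
    case (2 x)
    then have "x = \<one>" using xs(3) xc by simp
    then show ?thesis using noinv[of x x] 2 by simp
  next
    case (3 x y)
    then have "x \<otimes> y = \<one>" using xs(3) xc by simp
    then have "inv x = y" using xc 3 inv_equality[of y x] m_comm[of x y] by simp
    then show ?thesis using noinv[of x y] 3 by simp
  next
    case (4 x y z)
    have c: "x \<in> carrier G" "y \<in> carrier G" "z \<in> carrier G" using xc 4 by auto
    then have "(x \<otimes> y) \<otimes> z = \<one>" using xs(3) 4 by (simp add: m_assoc)
    then have "inv z = x \<otimes> y" using c by (intro inv_equality) auto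
    then show ?thesis
      using symmetric_sum_freeD(2)[OF S, of z] symmetric_sum_freeD(4)[OF S, of x y] xS 4 by simp
  qed
  then have "(\<Sum>a\<in>A. \<bar>l a\<bar>) = 0" using xs(2) by simp
  then show "\<forall>a\<in>A. l a = 0" using fin by (simp add: sum_nonneg_eq_0_iff)
qed

text \<open>Inversion acts on \<open>S\<close> without fixed points; one element of each pair
  \<open>{x, inv x}\<close> is selected, pair by pair.\<close>

lemma ex_half_of_symmetric:
  assumes "S \<subseteq> carrier G" "\<And>x. x \<in> S \<Longrightarrow> inv x \<in> S \<and> inv x \<noteq> x"
  shows "\<exists>A\<subseteq>S. (\<forall>a\<in>A. inv a \<notin> A) \<and> card S = 2 * card A"
  using assms
proof (induction "card S" arbitrary: S rule: less_induct)
  case less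
  show ?case
  proof (cases "S = {}")
    case True
    then show ?thesis by auto
  next
    case False
    then obtain x where x: "x \<in> S" by blast
    define S' where "S' = S - {x, inv x}"
    have fin: "finite S" using less.prems finite_subset_carrier by blast
    have xc: "x \<in> carrier G" "inv x \<in> S" "inv x \<noteq> x" using x less.prems by auto
    have "card S = card S' + card {x, inv x}"
      using fin x xc card_Diff_subset[of "{x, inv x}" S] card_mono[of S "{x, inv x}"]
      by (simp add: S'_def)
    then have c: "card S = card S' + 2" using xc by simp
    have "inv y \<in> S' \<and> inv y \<noteq> y" if y: "y \<in> S'" for y
      using y xc less.prems unfolding S'_def by (auto simp: subset_iff)
    then obtain A where A: "A \<subseteq> S'" "\<forall>a\<in>A. inv a \<notin> A" "card S' = 2 * card A"
      using less.hyps[of S'] c less.prems by (auto simp: S'_def)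
    have "x \<notin> A" "inv x \<notin> A" using A by (auto simp: S'_def)
    moreover have "finite A" using A fin finite_subset unfolding S'_def by blast
    moreover have "inv a \<noteq> x" if a: "a \<in> A" for a
    proof
      assume "inv a = x"
      then have "a = inv x" using a A(1) less.prems(1) by (auto simp: S'_def)
      then show False using a \<open>inv x \<notin> A\<close> by simp
    qed
    ultimately have "card S = 2 * card (insert x A)" "\<forall>a\<in>insert x A. inv a \<notin> insert x A"
      using A(2,3) xc c by auto
    moreover have "insert x A \<subseteq> S" using A(1) x by (auto simp: S'_def)
    ultimately show ?thesis by blast
  qed
qed

text \<open>\<open>a\<close>, \<open>b\<close>, \<open>c\<close> may coincide, so their coefficients
  may merge and cancel; only the sum of the coefficients survives. That is enough, as an odd number
  of signs never sums to \<open>0\<close>.\<close>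

lemma t_independent_3_relation:
  assumes A: "t_independent G 3 A" and abc: "a \<in> A" "b \<in> A" "c \<in> A"
    and w: "\<bar>i\<bar> + \<bar>j\<bar> + \<bar>k\<bar> \<le> (3::int)" and eq: "a [^] i \<otimes> b [^] j \<otimes> c [^] k = \<one>"
  shows "i + j + k = 0"
proof -
  define l where "l = (\<lambda>x. (if x = a then i else 0) + (if x = b then j else 0) + (if x = c then k else 0))"
  have fin: "finite A" and sub: "A \<subseteq> carrier G" using A by (auto simp: t_independent_def)
  have single: "(\<Otimes>x\<in>A. x [^] (if x = y then m else (0::int))) = y [^] m" if "y \<in> A" for y m
  proof -
    have "(\<Otimes>x\<in>A. x [^] (if x = y then m else (0::int))) = (\<Otimes>x\<in>A. if y = x then x [^] m else \<one>)"
      using sub by (intro finprod_cong') auto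
    also have "\<dots> = y [^] m"
      using that fin sub by (intro finprod_singleton) auto
    finally show ?thesis .
  qed
  have "(\<Otimes>x\<in>A. x [^] l x) = (\<Otimes>x\<in>A. (x [^] (if x = a then i else 0) \<otimes>
      x [^] (if x = b then j else 0)) \<otimes> x [^] (if x = c then k else 0))"
    using sub by (intro finprod_cong') (auto simp: l_def int_pow_mult)
  also have "\<dots> = (\<Otimes>x\<in>A. x [^] (if x = a then i else 0) \<otimes> x [^] (if x = b then j else 0)) \<otimes>
     (\<Otimes>x\<in>A. x [^] (if x = c then k else 0))"
    using sub by (intro finprod_multf) (auto simp del: int_pow_0)
  also have "\<dots> = (\<Otimes>x\<in>A. x [^] (if x = a then i else 0)) \<otimes> (\<Otimes>x\<in>A. x [^] (if x = b then j else 0)) \<otimes>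
     (\<Otimes>x\<in>A. x [^] (if x = c then k else 0))"
    using sub by (subst finprod_multf) (auto simp del: int_pow_0)
  also have "\<dots> = \<one>" using eq abc single by simp
  finally have "(\<Otimes>x\<in>A. x [^] l x) = \<one>" .
  moreover have "(\<Sum>x\<in>A. \<bar>l x\<bar>) \<le> int 3"
  proof -
    have "(\<Sum>x\<in>A. \<bar>l x\<bar>) \<le> (\<Sum>x\<in>A. (if x = a then \<bar>i\<bar> else 0) + (if x = b then \<bar>j\<bar> else 0) + (if x = c then \<bar>k\<bar> else 0))"
      by (rule sum_mono) (auto simp: l_def)
    also have "\<dots> = \<bar>i\<bar> + \<bar>j\<bar> + \<bar>k\<bar>" using fin abc by (simp add: sum.distrib)
    finally show ?thesis using w by simp
  qed
  ultimately have "\<forall>x\<in>A. l x = 0" using A unfolding t_independent_def by blast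
  then have "(\<Sum>x\<in>A. l x) = 0" by simp
  moreover have "(\<Sum>x\<in>A. l x) = i + j + k" using fin abc by (simp add: l_def sum.distrib)
  ultimately show ?thesis by simp
qed

lemma t_independent_3D:
  assumes A: "t_independent G 3 A"
  shows "\<exists>S. symmetric_sum_free S \<and> card S = 2 * card A"
proof -
  have fin: "finite A" and sub: "A \<subseteq> carrier G" using A by (auto simp: t_independent_def)
  define S where "S = A \<union> m_inv G ` A"
  have signed: "\<exists>a\<in>A. \<exists>i\<in>{1, - 1 :: int}. x = a [^] i" if "x \<in> S" for x
    using that sub by (auto simp: S_def int_pow_uminus_1 subset_iff)
  have noinv: "inv a \<noteq> b" if ab: "a \<in> A" "b \<in> A" for a b
  proof
    assume "inv a = b"
    \<comment> \<open>Padding with exponent \<open>0\<close> gives a relation of weight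
      \<open>2\<close>; the case \<open>a = b\<close> excludes involutions and
      \<open>\<one>\<close>.\<close>
    then have "a [^] (1::int) \<otimes> b [^] (1::int) \<otimes> b [^] (0::int) = \<one>" using ab sub by auto
    then show False using t_independent_3_relation[OF A ab(1,2,2), of 1 1 0] by simp
  qed
  have Sc: "S \<subseteq> carrier G" using sub by (auto simp: S_def)
  have inv: "inv x \<in> S" if "x \<in> S" for x
    using that sub by (auto simp: S_def subset_iff)
  have "inv x \<noteq> x" if "x \<in> S" for x
    using that sub noinv by (auto simp: S_def subset_iff)
  moreover have "x \<otimes> y \<notin> S" if xy: "x \<in> S" "y \<in> S" for x y
  proof
    assume "x \<otimes> y \<in> S"
    then have z: "inv (x \<otimes> y) \<in> S" by (rule inv)
    obtain a i b j c k where s: "a \<in> A" "i \<in> {1, - 1 :: int}" "x = a [^] i"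
      "b \<in> A" "j \<in> {1, - 1 :: int}" "y = b [^] j" "c \<in> A" "k \<in> {1, - 1 :: int}" "inv (x \<otimes> y) = c [^] k"
      using signed[OF xy(1)] signed[OF xy(2)] signed[OF z] by blast
    have "x \<otimes> y \<otimes> inv (x \<otimes> y) = \<one>" using xy Sc by (intro r_inv m_closed) auto
    then have "a [^] i \<otimes> b [^] j \<otimes> c [^] k = \<one>" using s by simp
    then have "i + j + k = 0"
      by (intro t_independent_3_relation[OF A s(1,4,7)]) (use s in auto)
    \<comment> \<open>Three signs have an odd sum.\<close>
    then show False using s(2,5,8) by auto
  qed
  ultimately have "symmetric_sum_free S"
    using Sc inv by (simp add: symmetric_sum_free_def)
  moreover have "card S = 2 * card A"
  proof -
    have "inj_on (m_inv G) A" using sub inv_inj inj_on_subset by blast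
    moreover have "A \<inter> m_inv G ` A = {}" using noinv by auto
    ultimately show ?thesis using fin by (simp add: S_def card_Un_disjoint card_image)
  qed
  ultimately show ?thesis by blast
qed

lemma finite_t_independent_cards: "finite (insert 0 (card ` {A. t_independent G t A}))"
proof -
  have "{A. t_independent G t A} \<subseteq> Pow (carrier G)" by (auto simp: t_independent_def)
  then show ?thesis by (meson finite_Pow_iff finite_carrier finite_imageI finite_insert finite_subset)
qed

lemma card_symmetric_sum_free_le:
  assumes S: "symmetric_sum_free S"
  shows "card S \<le> 2 * independence_size G 3"
proof (cases "S = {}")
  case False
  obtain A where A: "A \<subseteq> S" "\<forall>a\<in>A. inv a \<notin> A" "card S = 2 * card A"
    using ex_half_of_symmetric[of S] symmetric_sum_freeD[OF S] by blast
  have "finite S" using symmetric_sum_freeD(1)[OF S] finite_subset_carrier by blast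
  then have "A \<noteq> {}" using A False by auto
  then have "t_independent G 3 A" using t_independent_3I[OF S A(1)] A by blast
  then have "card A \<le> independence_size G 3"
    unfolding independence_size_def by (intro Max_ge[OF finite_t_independent_cards]) auto
  then show ?thesis using A by simp
qed simp

lemma independence_size_3_obtain:
  obtains S where "symmetric_sum_free S" "card S = 2 * independence_size G 3"
proof -
  have "independence_size G 3 \<in> insert 0 (card ` {A. t_independent G 3 A})"
    unfolding independence_size_def by (rule Max_in[OF finite_t_independent_cards]) simp
  then consider "independence_size G 3 = 0" | A where "t_independent G 3 A" "independence_size G 3 = card A"
    by auto
  then show thesis
  proof cases
    case 1
    \<comment> \<open>The default \<open>0\<close> of the maximum is realised by the empty
      set.\<close>
    then show ?thesis using that[of "{}"] by (simp add: symmetric_sum_free_def)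
  next
    case 2
    then show ?thesis using t_independent_3D that by metis
  qed
qed

section \<open>Upper bounds for sum-free sets\<close>

lemma card_dvd_card_periodic:
  assumes "periodic H C"
  shows "card H dvd card C"
proof -
  note H = periodicD[OF assms]
  have U: "\<Union> ((\<lambda>x. H #> x) ` C) = C"
    using periodic_r_coset_subset[OF assms] rcos_self[OF _ H(1)] H(2) by blast
  have "pairwise disjnt ((\<lambda>x. H #> x) ` C)"
    by (rule pairwise_subset[OF rcos_disjoint[OF H(1)]]) (use H(2) in \<open>auto simp: RCOSETS_def\<close>)
  then have "card H dvd card (\<Union> ((\<lambda>x. H #> x) ` C))"
    using finite_subset_carrier[OF H(2)] U card_r_coset[OF H(3)] H(2)
    by (intro dvd_partition) (auto simp: pairwise_def disjnt_def)
  then show ?thesis using U by simp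
qed

lemma sum_free_card_le_half:
  assumes S: "symmetric_sum_free S"
  shows "2 * card S \<le> order G"
proof (cases "S = {}")
  case False
  then obtain s where s: "s \<in> S" by blast
  note Sc = symmetric_sum_freeD(1)[OF S]
  have sc: "s \<in> carrier G" using s Sc by blast
  have "S \<inter> (\<otimes>) s ` S = {}" using s symmetric_sum_freeD(4)[OF S] by auto
  moreover have "S \<union> (\<otimes>) s ` S \<subseteq> carrier G" using s Sc by auto
  ultimately show ?thesis
    using card_Un_disjoint[of S "(\<otimes>) s ` S"] card_translate[OF sc Sc] finite_subset_carrier[OF Sc]
      card_mono[OF finite_carrier, of "S \<union> (\<otimes>) s ` S"]
    by (simp add: order_def)
qed simp

text \<open>
  With \<open>K\<close> the stabilizer of \<open>S S\<close>, the set \<open>K S\<close> is still disjoint from \<open>S S\<close>, so that Kneser's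
  theorem gives \<open>3 |K S| \<le> |G| + |K|\<close>. Here \<open>m\<close> is the index of \<open>K\<close> and \<open>q = |K S| / |K|\<close>.
\<close>

lemma sum_free_card_le_third:
  assumes S: "symmetric_sum_free S" and ne: "S \<noteq> {}"
  shows "\<exists>m q. m dvd order G \<and> 3 * q \<le> m + 1 \<and> card S * m \<le> order G * q"
proof -
  note Sc = symmetric_sum_freeD(1)[OF S]
  have SS: "S <#> S \<subseteq> carrier G" using Sc setmult_subset_G by blast
  define K where "K = stabilizer_of (S <#> S)"
  note perK = periodic_stabilizer_of[OF SS, folded K_def]
  note subK = periodicD(1)[OF perK] and Kc = periodicD(3)[OF perK]
  define T where "T = K <#> S"
  have Tc: "T \<subseteq> carrier G" unfolding T_def using Kc Sc setmult_subset_G by blast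
  have "\<one> \<in> K" using subK subgroup.one_closed by blast
  then have ST: "S \<subseteq> T" using Sc by (force simp: T_def set_mult_def)
  have perT: "periodic K T"
    unfolding periodic_def
  proof (intro conjI ballI)
    fix h x assume h: "h \<in> K" and "x \<in> T"
    then obtain k s where k: "k \<in> K" "s \<in> S" "x = k \<otimes> s" by (auto simp: T_def set_mult_def)
    have "h \<otimes> x = (h \<otimes> k) \<otimes> s" using k h Kc Sc by (simp add: m_assoc subset_iff)
    moreover have "h \<otimes> k \<in> K" using h k subK by (simp add: subgroup.m_closed)
    ultimately show "h \<otimes> x \<in> T" using k by (auto simp: T_def set_mult_def)
  qed (use subK Tc in auto)
  \<comment> \<open>The factors from \<open>K\<close> gather in front of a product from
    \<open>S S\<close>, which absorbs them.\<close>
  have "T <#> T \<subseteq> S <#> S"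
  proof
    fix z assume "z \<in> T <#> T"
    then obtain k s l t where z: "k \<in> K" "s \<in> S" "l \<in> K" "t \<in> S" "z = (k \<otimes> s) \<otimes> (l \<otimes> t)"
      by (auto simp: T_def set_mult_def)
    have c: "k \<in> carrier G" "s \<in> carrier G" "l \<in> carrier G" "t \<in> carrier G" using z Kc Sc by auto
    have "z = k \<otimes> (l \<otimes> (s \<otimes> t))" using c z(5) by (simp add: m_ac)
    moreover have "s \<otimes> t \<in> S <#> S" using z by (auto simp: set_mult_def)
    ultimately show "z \<in> S <#> S" using z(1,3) periodicD(4)[OF perK] by simp
  qed
  then have TT: "T <#> T = S <#> S" using mono_set_mult[OF ST ST] by blast
  have disj: "T \<inter> (S <#> S) = {}"
  proof -
    have "k \<otimes> s \<notin> S <#> S" if "k \<in> K" "s \<in> S" for k s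
    proof -
      have "s \<notin> S <#> S" using that symmetric_sum_freeD(4)[OF S] by (auto simp: set_mult_def)
      then show ?thesis using periodic_mult_iff[OF perK that(1), of s] that Sc by blast
    qed
    then show ?thesis by (auto simp: T_def set_mult_def[of G K])
  qed
  have "T \<noteq> {}" using ne ST by blast
  \<comment> \<open>Using \<open>T\<close> instead of \<open>S\<close> costs nothing on the product
    side, since \<open>T T = S S\<close>; and every period of \<open>S S\<close> lies in
    \<open>K\<close>.\<close>
  then obtain H where H: "periodic H (S <#> S)" "2 * card T \<le> card (S <#> S) + card H"
    using Kneser_weak[OF Tc Tc] TT by (metis mult_2)
  have "H \<subseteq> K" using periodicD[OF H(1)] by (auto simp: K_def stabilizer_of_def)
  then have "card H \<le> card K" using card_mono finite_subset_carrier[OF Kc] by blast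
  moreover have "card T + card (S <#> S) \<le> order G"
    using card_Un_disjoint[OF _ _ disj] finite_subset_carrier Tc SS
      card_mono[OF finite_carrier, of "T \<union> (S <#> S)"] by (simp add: order_def)
  ultimately have bound: "3 * card T \<le> order G + card K" using H(2) by linarith
  have pos: "card K > 0" using \<open>\<one> \<in> K\<close> finite_subset_carrier[OF Kc] card_gt_0_iff by blast
  obtain q where q: "card T = card K * q" using card_dvd_card_periodic[OF perT] by blast
  obtain m where m: "order G = card K * m"
    using lagrange_finite[OF finite_carrier subK] by (metis mult.commute)
  have "card K * (3 * q) \<le> card K * (m + 1)" using bound q m by (simp add: algebra_simps)
  then have "3 * q \<le> m + 1" using pos nat_mult_le_cancel1 by blast
  moreover have "card S * m \<le> order G * q"
    using card_mono[OF finite_subset_carrier[OF Tc] ST] q m by (simp add: mult.commute mult.left_commute mult_le_mono1)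
  moreover have "m dvd order G" using m by simp
  ultimately show ?thesis by blast
qed

text \<open>
  Double counting over the cosets of \<open>T = {x. x\<^sup>2 = 1}\<close>: if \<open>g T\<close> meets \<open>S\<close>, then a translate of
  \<open>S \<inter> g T\<close> lies in \<open>g\<^sup>2 T\<close> outside \<open>S\<close>; moreover squaring permutes the cosets of \<open>T\<close>.
\<close>

lemma sum_free_card_le_exponent_2_odd:
  fixes m :: nat
  assumes S: "symmetric_sum_free S" and m: "odd m" "\<And>x. x \<in> carrier G \<Longrightarrow> x [^] (2 * m) = \<one>"
  shows "2 * card S + card {x \<in> carrier G. x \<otimes> x = \<one>} \<le> order G"
proof -
  define T where "T = {x \<in> carrier G. x \<otimes> x = \<one>}"
  note Sc = symmetric_sum_freeD(1)[OF S]
  have Tc: "T \<subseteq> carrier G" by (auto simp: T_def)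
  have subT: "subgroup T G"
  proof (rule subgroup_of_closed)
    fix x y assume xy: "x \<in> T" "y \<in> T"
    then have "(x \<otimes> y) \<otimes> (x \<otimes> y) = (x \<otimes> x) \<otimes> (y \<otimes> y)" by (simp add: T_def m_ac)
    then show "x \<otimes> y \<in> T" using xy by (simp add: T_def)
  qed (auto simp: T_def)
  have finS: "finite S" and finT: "finite T" using finite_subset_carrier Sc Tc by auto
  have posT: "card T > 0" using subgroup.one_closed[OF subT] finT card_gt_0_iff by blast
  have ST: "S \<inter> T = {}"
  proof -
    have "inv x = x" if "x \<in> T" for x using that by (auto simp: T_def intro: inv_equality)
    then show ?thesis using symmetric_sum_freeD(3)[OF S] by blast
  qed
  \<comment> \<open>\<open>c g\<close> depends only on the coset \<open>T g\<close>, so a sum over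
    all \<open>g\<close> counts each coset \<open>|T|\<close> times.\<close>
  define c where "c g = card (S \<inter> (T #> g))" for g
  have fin_coset: "finite (T #> g)" if "g \<in> carrier G" for g
    using that finite_subset_carrier r_coset_subset_G Tc by blast
  have le: "c g + c (g \<otimes> g) \<le> card T" if g: "g \<in> carrier G" for g
  proof (cases "S \<inter> (T #> g) = {}")
    case True
    have "c (g \<otimes> g) \<le> card (T #> (g \<otimes> g))"
      unfolding c_def using fin_coset g by (intro card_mono) auto
    then show ?thesis using True card_r_coset[OF Tc] g by (simp add: c_def)
  next
    case False
    then obtain s where "s \<in> S" "s \<in> T #> g" by blast
    then obtain t where s: "s \<in> S" "t \<in> T" "s = t \<otimes> g" using mem_r_coset by blast
    have sc: "s \<in> carrier G" using s Sc by blast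
    let ?X = "(\<otimes>) s ` (S \<inter> (T #> g))"
    have "?X \<inter> (S \<inter> (T #> (g \<otimes> g))) = {}" using s(1) symmetric_sum_freeD(4)[OF S] by auto
    moreover have "?X \<subseteq> T #> (g \<otimes> g)"
    proof
      fix z assume "z \<in> ?X"
      then obtain u where u: "u \<in> T" "z = s \<otimes> (u \<otimes> g)" by (auto simp: mem_r_coset)
      then have "z = (t \<otimes> u) \<otimes> (g \<otimes> g)" using s Tc g by (simp add: m_ac subset_iff)
      moreover have "t \<otimes> u \<in> T" using s(2) u(1) subT by (simp add: subgroup.m_closed)
      ultimately show "z \<in> T #> (g \<otimes> g)" by (auto simp: mem_r_coset)
    qed
    ultimately have "card ?X + c (g \<otimes> g) \<le> card (T #> (g \<otimes> g))"
      unfolding c_def using fin_coset[of "g \<otimes> g"] g finS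
      by (subst card_Un_disjoint[symmetric]) (auto intro!: card_mono)
    moreover have "card ?X = c g" unfolding c_def using Sc by (intro card_translate[OF sc]) auto
    ultimately show ?thesis using card_r_coset[OF Tc] g by simp
  qed
  \<comment> \<open>The coset \<open>T\<close> itself meets \<open>S\<close> nowhere; this is the
    source of the extra \<open>|T|\<close> in the bound.\<close>
  have zero: "c g = 0" if "g \<in> T" for g
  proof -
    have "T #> g \<subseteq> T" using that subT by (auto simp: mem_r_coset subgroup.m_closed)
    then have "S \<inter> (T #> g) = {}" using ST by blast
    then show ?thesis by (simp add: c_def)
  qed
  have double: "(\<Sum>g\<in>carrier G. c (f g)) = (\<Sum>s\<in>S. card {g \<in> carrier G. s \<in> T #> f g})" for f
  proof -
    have "(\<Sum>g\<in>carrier G. c (f g)) = (\<Sum>g\<in>carrier G. \<Sum>s\<in>S. if s \<in> T #> f g then 1 else 0)"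
      unfolding c_def using finS by (simp add: sum.If_cases Int_def)
    also have "\<dots> = (\<Sum>s\<in>S. \<Sum>g\<in>carrier G. if s \<in> T #> f g then 1 else 0)" by (rule sum.swap)
    also have "\<dots> = (\<Sum>s\<in>S. card {g \<in> carrier G. s \<in> T #> f g})"
      by (simp add: sum.If_cases Int_def)
    finally show ?thesis .
  qed
  \<comment> \<open>A witness \<open>g0\<close> contributes its whole coset
    \<open>T g0\<close>.\<close>
  have count: "card T \<le> card {g \<in> carrier G. s \<in> T #> f g}"
    if "g0 \<in> carrier G" "\<And>t. t \<in> T \<Longrightarrow> s \<in> T #> f (t \<otimes> g0)" for s f g0
  proof -
    have "h \<otimes> g0 \<in> carrier G" if "h \<in> T" for h
      using that Tc \<open>g0 \<in> carrier G\<close> by blast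
    then have "T #> g0 \<subseteq> {g \<in> carrier G. s \<in> T #> f g}"
      using that(2) unfolding r_coset_def[of G T g0] by blast
    then have "card (T #> g0) \<le> card {g \<in> carrier G. s \<in> T #> f g}" by (rule card_mono[rotated]) simp
    then show ?thesis using card_r_coset[OF Tc that(1)] by simp
  qed
  have "card S * card T \<le> (\<Sum>g\<in>carrier G. c g)"
  proof -
    have "card T \<le> card {g \<in> carrier G. s \<in> T #> g}" if s: "s \<in> S" for s
    proof (rule count[of s _ "\<lambda>g. g"])
      fix t assume t: "t \<in> T"
      then have "s = t \<otimes> (t \<otimes> s)" using s Sc by (auto simp: T_def m_assoc[symmetric])
      then show "s \<in> T #> (t \<otimes> s)" using t by (auto simp: mem_r_coset)
    qed (use s Sc in auto)
    then have "(\<Sum>s\<in>S. card T) \<le> (\<Sum>s\<in>S. card {g \<in> carrier G. s \<in> T #> g})" by (rule sum_mono)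
    then show ?thesis using double[of "\<lambda>g. g"] by simp
  qed
  moreover have "card S * card T \<le> (\<Sum>g\<in>carrier G. c (g \<otimes> g))"
  proof -
    have "card T \<le> card {g \<in> carrier G. s \<in> T #> (g \<otimes> g)}" if s: "s \<in> S" for s
    \<comment> \<open>As \<open>m\<close> is odd, this witness is a square root of \<open>s\<close>
      modulo \<open>T\<close>: its square is \<open>s [^] m \<otimes> s\<close>, and
      \<open>s [^] m\<close> lies in \<open>T\<close> because
      \<open>s [^] (2 * m) = \<one>\<close>.\<close>
    proof (rule count[of "s [^] ((m + 1) div 2)" s "\<lambda>g. g \<otimes> g"])
      have sc: "s \<in> carrier G" using s Sc by blast
      then show "s [^] ((m + 1) div 2) \<in> carrier G" by simp
      fix t assume t: "t \<in> T"
      define h where "h = s [^] ((m + 1) div 2)"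
      have "(m + 1) div 2 + (m + 1) div 2 = m + 1" using m(1) by presburger
      then have "h \<otimes> h = s [^] (m + 1)"
        using sc unfolding h_def by (simp only: nat_pow_mult)
      then have hh: "h \<otimes> h = s [^] m \<otimes> s" by simp
      have mm: "s [^] m \<otimes> s [^] m = \<one>" using m(2)[OF sc] sc by (simp add: nat_pow_mult mult_2)
      have hc: "h \<in> carrier G" using sc by (simp add: h_def)
      have tc: "t \<in> carrier G" "t \<otimes> t = \<one>" using t by (auto simp: T_def)
      have "(t \<otimes> h) \<otimes> (t \<otimes> h) = (t \<otimes> t) \<otimes> (h \<otimes> h)" using tc(1) hc by (simp add: m_ac)
      then have "(t \<otimes> h) \<otimes> (t \<otimes> h) = s [^] m \<otimes> s" using tc hh sc by simp
      then have "s = s [^] m \<otimes> ((t \<otimes> h) \<otimes> (t \<otimes> h))" using sc mm by (simp add: m_assoc[symmetric])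
      moreover have "s [^] m \<in> T" using mm sc by (simp add: T_def)
      ultimately show "s \<in> T #> ((t \<otimes> s [^] ((m + 1) div 2)) \<otimes> (t \<otimes> s [^] ((m + 1) div 2)))"
        unfolding h_def mem_r_coset by blast
    qed
    then have "(\<Sum>s\<in>S. card T) \<le> (\<Sum>s\<in>S. card {g \<in> carrier G. s \<in> T #> (g \<otimes> g)})"
      by (rule sum_mono)
    then show ?thesis using double[of "\<lambda>g. g \<otimes> g"] by simp
  qed
  moreover have "(\<Sum>g\<in>carrier G. c g + c (g \<otimes> g)) \<le> (order G - card T) * card T"
  proof -
    have "(\<Sum>g\<in>carrier G. c g + c (g \<otimes> g)) = (\<Sum>g\<in>carrier G - T. c g + c (g \<otimes> g))"
      using zero subT Tc
      by (intro sum.mono_neutral_right) (auto simp: subgroup.m_closed)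
    also have "\<dots> \<le> (\<Sum>g\<in>carrier G - T. card T)" by (rule sum_mono) (use le in auto)
    also have "\<dots> = (order G - card T) * card T"
      using Tc finT by (simp add: card_Diff_subset order_def)
    finally show ?thesis .
  qed
  ultimately have "(2 * card S) * card T \<le> (order G - card T) * card T"
    unfolding sum.distrib by linarith
  then have "2 * card S \<le> order G - card T" using posT by simp
  moreover have "card T \<le> order G" using Tc by (simp add: order_def card_mono)
  ultimately show ?thesis unfolding T_def by linarith
qed

end

text \<open>A product of factors congruent to \<open>0\<close> or \<open>1\<close> modulo
  \<open>3\<close> is never \<open>2\<close>, so some prime factor is \<open>2\<close> modulo
  \<open>3\<close>; being odd, it is \<open>5\<close> modulo \<open>6\<close>.\<close>

lemma exists_prime_factor_5_mod_6:
  fixes m :: nat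
  assumes "odd m" "m mod 3 = 2"
  shows "\<exists>q. Factorial_Ring.prime q \<and> q dvd m \<and> [q = 5] (mod 6)"
  using assms
proof (induction m rule: less_induct)
  case (less m)
  have "m \<noteq> 1" using less.prems by auto
  then obtain q where q: "Factorial_Ring.prime q" "q dvd m" using prime_factor_nat by blast
  obtain k where k: "m = q * k" using q by blast
  have odd: "odd q" "odd k" using less.prems k by auto
  show ?case
  proof (cases "q mod 3 = 2")
    case True
    then have "q mod 6 = 5" using odd by presburger
    then show ?thesis using q by (auto simp: cong_def)
  next
    case False
    have "m mod 3 = (q mod 3) * (k mod 3) mod 3" by (simp add: k mod_mult_eq)
    moreover have "q mod 3 = 0 \<or> q mod 3 = 1" using False by presburger
    ultimately have "k mod 3 = 2" using less.prems by auto
    moreover have "k < m" using k q less.prems prime_gt_1_nat[OF q(1)] by (cases "k = 0") auto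
    ultimately show ?thesis using less.IH[of k] odd k by (auto intro: dvd_mult)
  qed
qed

section \<open>Characters\<close>

context finite_comm_group
begin

text \<open>A homomorphism from \<open>H\<close> to \<open>\<int>/k\<close>, kept as an
  integer-valued function whose values matter only modulo \<open>k\<close>.\<close>

definition character_on :: "'a set \<Rightarrow> nat \<Rightarrow> ('a \<Rightarrow> int) \<Rightarrow> bool" where
  "character_on H k f \<longleftrightarrow> (\<forall>x\<in>H. \<forall>y\<in>H. [f (x \<otimes> y) = f x + f y] (mod int k))"

lemma character_onD:
  "character_on H k f \<Longrightarrow> x \<in> H \<Longrightarrow> y \<in> H \<Longrightarrow> [f (x \<otimes> y) = f x + f y] (mod int k)"
  by (simp add: character_on_def)

lemma character_on_one:
  assumes "subgroup H G" "character_on H k f"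
  shows "[f \<one> = 0] (mod int k)"
proof -
  have "[f (\<one> \<otimes> \<one>) = f \<one> + f \<one>] (mod int k)"
    using assms character_onD subgroup.one_closed by metis
  then show ?thesis by (simp add: cong_iff_dvd_diff)
qed

lemma character_on_pow:
  assumes H: "subgroup H G" "character_on H k f" and x: "x \<in> H"
  shows "[f (x [^] i) = int i * f x] (mod int k)"
proof (induction i)
  case 0
  then show ?case using character_on_one[OF H] by simp
next
  case (Suc i)
  have "x [^] i \<in> H"
    using x H by (metis subgroup_int_pow_closed int_pow_int)
  then have "[f (x [^] i \<otimes> x) = f (x [^] i) + f x] (mod int k)"
    using character_onD[OF H(2)] x by blast
  also have "[f (x [^] i) + f x = int i * f x + f x] (mod int k)"
    using Suc by (intro cong_add) auto
  finally show ?case by (simp add: algebra_simps)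
qed

text \<open>With \<open>d\<close> the order of \<open>x\<close> modulo \<open>H\<close>, the value
  \<open>c\<close> at \<open>x\<close> has to satisfy \<open>d c = f (x [^] d)\<close> modulo
  \<open>k\<close>. It exists: \<open>k = d e\<close> and \<open>e f (x [^] d)\<close> vanishes
  modulo \<open>k\<close>, so \<open>d\<close> divides \<open>f (x [^] d)\<close>.\<close>

lemma character_on_adjoin:
  assumes H: "subgroup H G" and f: "character_on H k f" and k: "0 < k"
    and exp: "\<And>y. y \<in> carrier G \<Longrightarrow> y [^] k = \<one>" and x: "x \<in> carrier G"
  shows "\<exists>H' f'. subgroup H' G \<and> H \<subseteq> H' \<and> x \<in> H' \<and> character_on H' k f' \<and>
    (\<forall>h\<in>H. [f' h = f h] (mod int k))"
proof -
  note Hc = subgroup.subset[OF H]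
  have one: "\<one> \<in> H" using subgroup.one_closed[OF H] .
  have mult: "y \<otimes> z \<in> H" if "y \<in> H" "z \<in> H" for y z using that subgroup.m_closed[OF H] by simp
  have pow: "y [^] i \<in> H" if "y \<in> H" for y and i :: nat
    by (induction i) (use that one mult in auto)
  define d :: nat where "d = (LEAST d. 0 < d \<and> x [^] d \<in> H)"
  have "0 < k \<and> x [^] k \<in> H" using k exp x one by simp
  then have d: "0 < d \<and> x [^] d \<in> H" unfolding d_def by (rule LeastI)
  have d_dvd: "d dvd i" if i: "x [^] i \<in> H" for i :: nat
  proof -
    have "x [^] i = x [^] (i mod d) \<otimes> (x [^] d) [^] (i div d)"
      using x by (simp add: nat_pow_pow nat_pow_mult)
    moreover have "(x [^] d) [^] (i div d) \<in> H" using pow d by blast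
    ultimately have "x [^] (i mod d) = x [^] i \<otimes> inv ((x [^] d) [^] (i div d))"
      using x Hc by (intro inv_solve_right[THEN iffD2]) auto
    moreover have "inv ((x [^] d) [^] (i div d)) \<in> H"
      using pow d subgroup.m_inv_closed[OF H] by simp
    ultimately have "x [^] (i mod d) \<in> H" using i mult by simp
    then have "\<not> 0 < i mod d"
      using not_less_Least[of "i mod d" "\<lambda>d. 0 < d \<and> x [^] d \<in> H", folded d_def] d by auto
    then show ?thesis by auto
  qed
  have "d dvd k" using d_dvd exp[OF x] one by simp
  then obtain e where e: "k = d * e" by blast
  have "[f ((x [^] d) [^] e) = int e * f (x [^] d)] (mod int k)"
    using character_on_pow[OF H f] d by blast
  moreover have "(x [^] d) [^] e = \<one>" using exp[OF x] x e by (simp add: nat_pow_pow)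
  ultimately have "[int e * f (x [^] d) = 0] (mod int k)"
    using character_on_one[OF H f] by (metis cong_sym cong_trans)
  then have "int d * int e dvd f (x [^] d) * int e" by (simp add: cong_0_iff e mult.commute)
  then have "int d dvd f (x [^] d)" using e k by simp
  \<comment> \<open>The extension should send \<open>h x^i\<close> to \<open>f h + i c\<close>. This
    way of writing an element is not unique, so \<open>P\<close> is a relation, single-valued modulo
    \<open>k\<close> by \<open>wd\<close>, and \<open>f'\<close> picks any of its values.\<close>
  then obtain c where c: "f (x [^] d) = int d * c" by blast
  define P where "P y v \<longleftrightarrow> (\<exists>h\<in>H. \<exists>i::nat. y = h \<otimes> x [^] i \<and> v = f h + int i * c)" for y v
  have wd: "[f h + int i * c = f h' + int j * c] (mod int k)"
    if eq: "h \<otimes> x [^] i = h' \<otimes> x [^] j" and hh: "h \<in> H" "h' \<in> H" and ij: "i \<le> j" for h h' i j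
  proof -
    have hc: "h \<in> carrier G" "h' \<in> carrier G" using hh Hc by auto
    have "h' \<otimes> x [^] j = (h' \<otimes> x [^] (j - i)) \<otimes> x [^] i"
      using x hc ij by (simp add: m_assoc nat_pow_mult)
    then have h: "h = h' \<otimes> x [^] (j - i)"
      using eq x hc by simp
    then have "x [^] (j - i) = inv h' \<otimes> h" using x hc by (simp add: m_assoc[symmetric])
    moreover have "inv h' \<otimes> h \<in> H" using hh mult subgroup.m_inv_closed[OF H] by simp
    ultimately have "x [^] (j - i) \<in> H" by simp
    then obtain q where q: "j - i = d * q" using d_dvd by blast
    have xq: "(x [^] d) [^] q \<in> H" using d pow by blast
    have "h = h' \<otimes> (x [^] d) [^] q" using h q x by (simp add: nat_pow_pow)
    then have "[f h = f h' + f ((x [^] d) [^] q)] (mod int k)"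
      using character_onD[OF f hh(2) xq] by simp
    also have "[f h' + f ((x [^] d) [^] q) = f h' + int q * f (x [^] d)] (mod int k)"
      using character_on_pow[OF H f, of "x [^] d" q] d by (intro cong_add) simp_all
    also have "f h' + int q * f (x [^] d) = f h' + (int j - int i) * c"
    proof -
      have "int j - int i = int d * int q" using q ij by (simp flip: of_nat_diff)
      then show ?thesis using c by simp
    qed
    finally have "[f h + int i * c = f h' + (int j - int i) * c + int i * c] (mod int k)"
      by (intro cong_add) auto
    then show ?thesis by (simp add: algebra_simps)
  qed
  have P_unique: "[v = w] (mod int k)" if "P y v" "P y w" for y v w
  proof -
    obtain h i h' j where *: "h \<in> H" "h' \<in> H" "y = h \<otimes> x [^] i" "v = f h + int i * c"
      "y = h' \<otimes> x [^] j" "w = f h' + int j * c"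
      using \<open>P y v\<close> \<open>P y w\<close> unfolding P_def by blast
    show ?thesis
    proof (cases "i \<le> j")
      case True
      then show ?thesis using wd[of h i h' j] * by simp
    next
      case False
      then have "[w = v] (mod int k)" using wd[of h' j h i] * by simp
      then show ?thesis by (rule cong_sym)
    qed
  qed
  define f' where "f' y = (SOME v. P y v)" for y
  have f': "[f' (h \<otimes> x [^] i) = f h + int i * c] (mod int k)" if "h \<in> H" for h and i :: nat
  proof -
    have "P (h \<otimes> x [^] i) (f h + int i * c)" using that by (auto simp: P_def)
    then show ?thesis unfolding f'_def using P_unique by (metis someI)
  qed
  define H' where "H' = {h \<otimes> x [^] i | h i. h \<in> H \<and> i \<in> (UNIV :: nat set)}"
  have prod: "(h \<otimes> x [^] i) \<otimes> (h' \<otimes> x [^] j) = (h \<otimes> h') \<otimes> x [^] (i + j)"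
    if "h \<in> H" "h' \<in> H" for h h' and i j :: nat
  proof -
    have "h \<in> carrier G" "h' \<in> carrier G" using that Hc by auto
    then show ?thesis using x by (simp add: m_ac flip: nat_pow_mult)
  qed
  have "subgroup H' G"
  proof (rule subgroup_of_closed)
    show "H' \<subseteq> carrier G" using Hc x by (auto simp: H'_def)
    have "\<one> = \<one> \<otimes> x [^] (0::nat)" by simp
    then show "\<one> \<in> H'" using one unfolding H'_def by blast
    fix y z assume "y \<in> H'" "z \<in> H'"
    then show "y \<otimes> z \<in> H'" using prod mult unfolding H'_def by blast
  qed
  moreover have HH': "H \<subseteq> H'"
  proof
    fix h assume h: "h \<in> H"
    then have "h = h \<otimes> x [^] (0::nat)" using Hc by auto
    then show "h \<in> H'" using h unfolding H'_def by blast
  qed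
  moreover have "x \<in> H'"
  proof -
    have "x = \<one> \<otimes> x [^] (1::nat)" using x by simp
    then show ?thesis using one unfolding H'_def by blast
  qed
  moreover have "character_on H' k f'"
    unfolding character_on_def
  proof (intro ballI)
    fix y z assume "y \<in> H'" "z \<in> H'"
    then obtain h i h' j where *: "h \<in> H" "h' \<in> H" "y = h \<otimes> x [^] (i::nat)" "z = h' \<otimes> x [^] (j::nat)"
      unfolding H'_def by blast
    have "[f' (y \<otimes> z) = f (h \<otimes> h') + int (i + j) * c] (mod int k)"
      using f'[of "h \<otimes> h'" "i + j"] * mult prod by simp
    also have "[f (h \<otimes> h') + int (i + j) * c = (f h + f h') + int (i + j) * c] (mod int k)"
      using character_onD[OF f] * by (intro cong_add) auto
    also have "(f h + f h') + int (i + j) * c = (f h + int i * c) + (f h' + int j * c)"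
      by (simp add: algebra_simps)
    also have "[(f h + int i * c) + (f h' + int j * c) = f' y + f' z] (mod int k)"
      using f'[of h i] f'[of h' j] * by (intro cong_add) (auto intro: cong_sym)
    finally show "[f' (y \<otimes> z) = f' y + f' z] (mod int k)" .
  qed
  moreover have "[f' h = f h] (mod int k)" if "h \<in> H" for h
    using f'[OF that, of 0] that Hc by auto
  ultimately show ?thesis by blast
qed

lemma character_on_extend:
  assumes "subgroup H G" "character_on H k f" "0 < k"
    and exp: "\<And>y. y \<in> carrier G \<Longrightarrow> y [^] k = \<one>"
  shows "\<exists>F. character_on (carrier G) k F \<and> (\<forall>h\<in>H. [F h = f h] (mod int k))"
  using assms(1,2)
proof (induction "order G - card H" arbitrary: H f rule: less_induct)
  case less
  note Hc = subgroup.subset[OF less.prems(1)]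
  show ?case
  proof (cases "H = carrier G")
    case True
    then show ?thesis using less.prems by auto
  next
    case False
    then obtain x where x: "x \<in> carrier G" "x \<notin> H" using Hc by blast
    obtain H' f' where H': "subgroup H' G" "H \<subseteq> H'" "x \<in> H'" "character_on H' k f'"
      "\<forall>h\<in>H. [f' h = f h] (mod int k)"
      using character_on_adjoin[OF less.prems assms(3) exp x(1)] by blast
    have fin: "finite H'" using H'(1) finite_subset_carrier subgroup.subset by blast
    have "card H < card H'" using H' x fin by (intro psubset_card_mono) auto
    moreover have "card H' \<le> order G"
      unfolding order_def using H'(1) by (intro card_mono) (auto dest: subgroup.subset)
    ultimately obtain F where F: "character_on (carrier G) k F" "\<forall>h\<in>H'. [F h = f' h] (mod int k)"
      using less.hyps[OF _ H'(1,4)] by (metis diff_less_mono2 order_less_le_trans)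
    then show ?thesis using H' by (meson cong_trans subsetD)
  qed
qed

section \<open>The exponent as the order of an element\<close>

lemma ord_mult_dvd_ord_mult:
  assumes a: "a \<in> carrier G" and b: "b \<in> carrier G" and cop: "coprime (ord a) (ord b)"
  shows "ord a * ord b dvd ord (a \<otimes> b)"
proof -
  have *: "ord a dvd ord (a \<otimes> b)"
    if "a \<in> carrier G" "b \<in> carrier G" "coprime (ord a) (ord b)" for a b
  proof -
    have "(a \<otimes> b) [^] (ord (a \<otimes> b) * ord b) = \<one>" using that by (simp add: pow_eq_id)
    then have "a [^] (ord (a \<otimes> b) * ord b) \<otimes> b [^] (ord (a \<otimes> b) * ord b) = \<one>"
      using that by (simp add: nat_pow_distrib)
    moreover have "b [^] (ord (a \<otimes> b) * ord b) = \<one>" using that by (simp add: pow_eq_id)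
    ultimately have "ord a dvd ord (a \<otimes> b) * ord b" using that by (simp add: pow_eq_id)
    then show ?thesis using that(3) coprime_dvd_mult_left_iff by blast
  qed
  have "ord b dvd ord (a \<otimes> b)"
    using *[OF b a] cop m_comm[OF a b] by (simp add: coprime_commute)
  then show ?thesis using *[OF a b cop] cop divides_mult by blast
qed

text \<open>Take \<open>g\<close> of maximal order. If a prime \<open>p\<close> had a higher
  multiplicity \<open>j\<close> in \<open>ord x\<close> than its multiplicity \<open>i\<close> in
  \<open>ord g = p ^ i * M\<close>, then \<open>g [^] (p ^ i)\<close> and a suitable power of
  \<open>x\<close> would have the coprime orders \<open>M\<close> and \<open>p ^ j\<close>, and
  their product an order above \<open>ord g\<close>.\<close>

lemma exists_ord_dvd_ord:
  "\<exists>g\<in>carrier G. \<forall>x\<in>carrier G. ord x dvd ord g"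
proof -
  have ne: "finite (ord ` carrier G)" "ord ` carrier G \<noteq> {}" by auto
  then have "Max (ord ` carrier G) \<in> ord ` carrier G" by (rule Max_in)
  then obtain g where g: "g \<in> carrier G" "ord g = Max (ord ` carrier G)" by auto
  have max: "ord y \<le> ord g" if "y \<in> carrier G" for y using that g(2) ne by simp
  have pos: "ord y > 0" if "y \<in> carrier G" for y using ord_ge_1[OF finite_carrier that] by simp
  have "ord x dvd ord g" if x: "x \<in> carrier G" for x
  proof (rule ccontr)
    assume "\<not> ord x dvd ord g"
    then obtain p where p: "Factorial_Ring.prime p" "multiplicity p (ord g) < multiplicity p (ord x)"
      using multiplicity_le_imp_dvd[of "ord x" "ord g"] pos[OF x] by (metis leI neq0_conv)
    define i where "i = multiplicity p (ord g)"
    define j where "j = multiplicity p (ord x)"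
    have np: "\<not> is_unit p" using p(1) not_prime_unit by blast
    obtain M where M: "ord g = p ^ i * M" "\<not> p dvd M"
      unfolding i_def using multiplicity_decompose'[OF _ np] pos[OF g(1)] by (metis neq0_conv)
    obtain N where N: "ord x = p ^ j * N" "\<not> p dvd N"
      unfolding j_def using multiplicity_decompose'[OF _ np] pos[OF x] by (metis neq0_conv)
    have Mpos: "M > 0" "N > 0" using pos[OF g(1)] pos[OF x] M(1) N(1) by (auto intro: gr0I)
    have p0: "p > 0" using p(1) prime_gt_0_nat by blast
    define a where "a = g [^] (p ^ i)"
    define b where "b = x [^] N"
    have ab: "a \<in> carrier G" "b \<in> carrier G" using g x by (auto simp: a_def b_def)
    have oa: "ord a = M" unfolding a_def using ord_pow[of g "p ^ i"] g(1) M(1) p0 by simp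
    have ob: "ord b = p ^ j" unfolding b_def using ord_pow[of x N] x N(1) Mpos by simp
    have "coprime p M" using p(1) M(2) prime_imp_coprime by blast
    then have "coprime (ord a) (ord b)" using oa ob by (simp add: coprime_commute)
    then have "M * p ^ j dvd ord (a \<otimes> b)" using ord_mult_dvd_ord_mult[OF ab] oa ob by simp
    then have "M * p ^ j \<le> ord (a \<otimes> b)" using pos ab by (simp add: dvd_imp_le)
    also have "\<dots> \<le> ord g" using max ab by simp
    finally have "p ^ j \<le> p ^ i" using M(1) Mpos by (simp add: mult.commute)
    moreover have "p ^ i < p ^ j"
      using p prime_gt_1_nat[OF p(1)] by (simp add: i_def j_def)
    ultimately show False by simp
  qed
  then show ?thesis using g by blast
qed

lemma group_exponent_eq_ord:
  obtains g where "g \<in> carrier G" "ord g = group_exponent G"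
    "\<And>x. x \<in> carrier G \<Longrightarrow> ord x dvd group_exponent G"
proof -
  obtain g where g: "g \<in> carrier G" "\<And>x. x \<in> carrier G \<Longrightarrow> ord x dvd ord g"
    using exists_ord_dvd_ord by blast
  have "group_exponent G = ord g"
    unfolding group_exponent_def
  proof (rule Least_equality)
    show "0 < ord g \<and> (\<forall>x\<in>carrier G. x [^] ord g = \<one>)"
      using g ord_ge_1[OF finite_carrier g(1)] by (auto simp: pow_eq_id)
    fix y :: nat assume "0 < y \<and> (\<forall>x\<in>carrier G. x [^] y = \<one>)"
    then have "ord g dvd y" "0 < y" using g by (auto simp: pow_eq_id)
    then show "ord g \<le> y" by (simp add: dvd_imp_le)
  qed
  then show thesis using that g by metis
qed

text \<open>On the powers of an element \<open>g\<close> whose order is the exponent, the discrete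
  logarithm is a character. It extends to \<open>G\<close>, and the value \<open>1\<close> at
  \<open>g\<close> makes it onto.\<close>

lemma exists_surjective_character:
  obtains f g where "character_on (carrier G) (group_exponent G) f" "g \<in> carrier G"
    "[f g = 1] (mod int (group_exponent G))"
proof -
  obtain g where g: "g \<in> carrier G" "ord g = group_exponent G"
    "\<And>x. x \<in> carrier G \<Longrightarrow> ord x dvd group_exponent G"
    using group_exponent_eq_ord by blast
  define k where "k = group_exponent G"
  have k: "ord g = k" "0 < k" "\<And>x. x \<in> carrier G \<Longrightarrow> x [^] k = \<one>"
    using g ord_ge_1[OF finite_carrier g(1)] by (auto simp: k_def pow_eq_id)
  define H where "H = range (\<lambda>i::int. g [^] i)"
  define f where "f y = (SOME i::int. y = g [^] i)" for y
  have H: "subgroup H G" unfolding H_def using subgroup_of_powers g(1) by blast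
  have f: "g [^] f y = y" if y: "y \<in> H" for y
  proof -
    obtain i :: int where "y = g [^] i" using y by (auto simp: H_def)
    then have "y = g [^] f y" unfolding f_def by (rule someI)
    then show ?thesis by simp
  qed
  have cong: "[i = j] (mod int k)" if "g [^] i = g [^] j" for i j :: int
    using that int_pow_eq[OF g(1), of j i] k(1) by (simp add: cong_iff_dvd_diff)
  have "character_on H k f"
    unfolding character_on_def
  proof (intro ballI cong)
    fix x y assume xy: "x \<in> H" "y \<in> H"
    then have "x \<otimes> y \<in> H" using subgroup.m_closed[OF H] by simp
    then have "g [^] f (x \<otimes> y) = x \<otimes> y" by (rule f)
    also have "\<dots> = g [^] (f x + f y)" using f xy g(1) by (simp add: int_pow_mult)
    finally show "g [^] f (x \<otimes> y) = g [^] (f x + f y)" .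
  qed
  then obtain F where F: "character_on (carrier G) k F" "\<forall>h\<in>H. [F h = f h] (mod int k)"
    using character_on_extend[OF H _ k(2,3)] by blast
  have "g = g [^] (1::int)" using g(1) by simp
  then have gH: "g \<in> H" unfolding H_def by blast
  then have "[f g = 1] (mod int k)" using f g(1) by (intro cong) simp
  then have "[F g = 1] (mod int k)" using F gH cong_trans by blast
  then show thesis using that F g(1) unfolding k_def by blast
qed

section \<open>The values of \<open>s(G,3)\<close>\<close>

text \<open>Multiplying by a power of \<open>g\<close> carries any fibre into any other, so all
  \<open>m\<close> fibres have the same size.\<close>

lemma card_character_fibers:
  assumes f: "character_on (carrier G) m f" and g: "g \<in> carrier G" "[f g = 1] (mod int m)"
    and R: "R \<subseteq> {0..<int m}"
  shows "card {x \<in> carrier G. f x mod int m \<in> R} * m = card R * order G"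
proof -
  define F where "F r = {x \<in> carrier G. f x mod int m = r}" for r
  have fin: "finite (F r)" for r unfolding F_def by (rule finite_subset_carrier) auto
  have finR: "finite R" using R finite_subset by blast
  have le: "card (F r) \<le> card (F s)" if s: "s \<in> {0..<int m}" for r s
  proof -
    define k where "k = nat ((s - r) mod int m)"
    have k: "int k = (s - r) mod int m" using s by (simp add: k_def)
    have gk: "[f (g [^] k) = int k] (mod int m)"
    proof -
      have "subgroup (carrier G) G" by (rule subgroup_self)
      then have "[f (g [^] k) = int k * f g] (mod int m)" using character_on_pow f g(1) by blast
      also have "[int k * f g = int k * 1] (mod int m)" using g(2) by (rule cong_mult[OF cong_refl])
      finally show ?thesis by simp
    qed
    show ?thesis
    proof (rule card_translate_le[of "g [^] k"])
      fix x assume x: "x \<in> F r"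
      then have xc: "x \<in> carrier G" and xr: "f x mod int m = r" by (auto simp: F_def)
      have "[f (g [^] k \<otimes> x) = f (g [^] k) + f x] (mod int m)"
        using character_onD[OF f] g xc by simp
      also have "[f (g [^] k) + f x = (s - r) + r] (mod int m)"
        using gk xr by (intro cong_add) (auto simp: cong_def k)
      finally have "f (g [^] k \<otimes> x) mod int m = s" using s by (simp add: cong_def)
      then show "g [^] k \<otimes> x \<in> F s" using g xc by (simp add: F_def)
    qed (use g in \<open>auto simp: F_def\<close>)
  qed
  have union: "card {x \<in> carrier G. f x mod int m \<in> Q} = (\<Sum>r\<in>Q. card (F r))" if "finite Q" for Q
  proof -
    have "{x \<in> carrier G. f x mod int m \<in> Q} = (\<Union>r\<in>Q. F r)" by (auto simp: F_def)
    then show ?thesis using that fin by (simp add: card_UN_disjoint F_def disjoint_iff)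
  qed
  have const: "card (F r) = card (F 0)" if "r \<in> {0..<int m}" for r
    using le[of r 0] le[of 0 r] that by (simp add: le_antisym)
  show ?thesis
  proof (cases "m = 0")
    case True
    then show ?thesis using R by simp
  next
    case False
    then have "{x \<in> carrier G. f x mod int m \<in> {0..<int m}} = carrier G" by auto
    then have "order G = (\<Sum>r\<in>{0..<int m}. card (F r))"
      using union[of "{0..<int m}"] by (simp add: order_def)
    also have "\<dots> = (\<Sum>r\<in>{0..<int m}. card (F 0))" by (rule sum.cong[OF refl const])
    finally have "order G = m * card (F 0)" by simp
    moreover have "(\<Sum>r\<in>R. card (F r)) = (\<Sum>r\<in>R. card (F 0))"
      by (rule sum.cong[OF refl const]) (use R in blast)
    then have "card {x \<in> carrier G. f x mod int m \<in> R} = card R * card (F 0)"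
      using union[OF finR] by simp
    ultimately show ?thesis by simp
  qed
qed

text \<open>\<open>S\<close> may be smaller than the full preimage, and
  \<open>inv x \<noteq> x\<close> is assumed on \<open>S\<close> itself: modulo \<open>2\<close> the
  residue \<open>1\<close> is its own negative, and there the involutions are removed by
  hand.\<close>

lemma symmetric_sum_free_preimage:
  assumes f: "character_on (carrier G) m f"
    and R: "\<And>r. r \<in> R \<Longrightarrow> (- r) mod int m \<in> R" "\<And>r s. r \<in> R \<Longrightarrow> s \<in> R \<Longrightarrow> (r + s) mod int m \<notin> R"
    and inv_neq: "\<And>x. x \<in> S \<Longrightarrow> inv x \<noteq> x" and S: "S \<subseteq> {x \<in> carrier G. f x mod int m \<in> R}"
    "\<And>x. x \<in> S \<Longrightarrow> inv x \<in> S"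
  shows "symmetric_sum_free S"
  unfolding symmetric_sum_free_def
proof (intro conjI ballI inv_neq)
  fix x y assume xy: "x \<in> S" "y \<in> S"
  then have "f (x \<otimes> y) mod int m = (f x mod int m + f y mod int m) mod int m"
    using character_onD[OF f, of x y] S(1) by (auto simp: cong_def mod_add_eq)
  moreover have "f x mod int m \<in> R" "f y mod int m \<in> R" using xy S(1) by auto
  ultimately have "f (x \<otimes> y) mod int m \<notin> R" using R(2) by simp
  then show "x \<otimes> y \<notin> S" using S(1) by auto
qed (use S in auto)

lemma character_inv:
  assumes "character_on (carrier G) m f" "x \<in> carrier G"
  shows "f (inv x) mod int m = (- (f x mod int m)) mod int m"
proof -
  have "[f (x \<otimes> inv x) = f x + f (inv x)] (mod int m)"
    using assms character_onD by blast
  then have "[f x + f (inv x) = f \<one>] (mod int m)" using assms by (simp add: cong_sym)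
  moreover have "[f \<one> = 0] (mod int m)" using assms character_on_one subgroup_self by blast
  ultimately have "[f x + f (inv x) = 0] (mod int m)" by (rule cong_trans)
  then have "[f (inv x) = - f x] (mod int m)"
    by (simp add: cong_iff_dvd_diff add.commute)
  then show ?thesis by (simp add: cong_def mod_minus_eq)
qed

lemma character_on_dvd:
  assumes "character_on H k f" "m dvd k"
  shows "character_on H m f"
  using assms unfolding character_on_def by (meson cong_dvd_modulus of_nat_dvd_iff)

text \<open>No residue in \<open>R\<close> is its own negative, so the full preimage qualifies;
  equal fibres give its size.\<close>

lemma independence_size_ge_preimage:
  assumes m: "m dvd group_exponent G" and Rm: "R \<subseteq> {0..<int m}"
    and R: "\<And>r. r \<in> R \<Longrightarrow> (- r) mod int m \<in> R \<and> (- r) mod int m \<noteq> r"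
      "\<And>r s. r \<in> R \<Longrightarrow> s \<in> R \<Longrightarrow> (r + s) mod int m \<notin> R"
  shows "card R * order G \<le> 2 * independence_size G 3 * m"
proof -
  obtain f g where "character_on (carrier G) (group_exponent G) f" and g: "g \<in> carrier G"
    "[f g = 1] (mod int (group_exponent G))"
    using exists_surjective_character by blast
  then have f: "character_on (carrier G) m f" "[f g = 1] (mod int m)"
    using m by (auto intro: character_on_dvd cong_dvd_modulus)
  define S where "S = {x \<in> carrier G. f x mod int m \<in> R}"
  have Sinv: "inv x \<in> S \<and> inv x \<noteq> x" if "x \<in> S" for x
    using that R(1) character_inv[OF f(1), of x] by (auto simp: S_def) metis
  have "symmetric_sum_free S"
    by (rule symmetric_sum_free_preimage[OF f(1), of R]) (use R Sinv in \<open>auto simp: S_def\<close>)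
  then have "card S \<le> 2 * independence_size G 3" by (rule card_symmetric_sum_free_le)
  then have "card S * m \<le> 2 * independence_size G 3 * m" by (rule mult_le_mono1)
  then show ?thesis using card_character_fibers[OF f(1) g(1) f(2) Rm] by (simp add: S_def)
qed

text \<open>Pulls back the \<open>2 k\<close> residues closest to \<open>m / 2\<close>.\<close>

lemma independence_size_ge_middle_third:
  assumes m: "m dvd group_exponent G" "odd m" and k: "6 * k \<le> m + 1"
  shows "k * order G \<le> independence_size G 3 * m"
proof -
  obtain h where h: "m = 2 * h + 1" using m(2) by (auto elim: oddE)
  \<comment> \<open>\<open>R\<close> is centred at \<open>m / 2 = h + 1 / 2\<close>, so negation
    modulo \<open>m\<close> preserves it, without a fixed point since \<open>m\<close> is
    odd.\<close>
  define R where "R = {int h + 1 - int k..int h + int k}"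
  have kh: "3 * k \<le> h + 1" using k h by simp
  have red: "z mod int m = z + q * int m" if "0 \<le> z + q * int m" "z + q * int m < int m" for z q
    using that by (metis mod_mult_self1 mod_pos_pos_trivial mult.commute)
  have neg: "(- r) mod int m = int m - r" if "r \<in> R" for r
    using red[of "- r" 1] that kh by (auto simp: R_def h)
  have "card R * order G \<le> 2 * independence_size G 3 * m"
  proof (rule independence_size_ge_preimage[OF m(1)])
    show "R \<subseteq> {0..<int m}" using kh by (auto simp: R_def h)
    fix r assume r: "r \<in> R"
    have "int m - r \<in> R" using r by (auto simp: R_def h)
    moreover have "int m - r \<noteq> r" unfolding h by presburger
    ultimately show "(- r) mod int m \<in> R \<and> (- r) mod int m \<noteq> r" using neg[OF r] by simp
    fix s assume s: "s \<in> R"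
    \<comment> \<open>By \<open>3 k \<le> h + 1\<close>, an unreduced sum is at least
      \<open>2 h + 2 - 2 k > h + k\<close>, and a sum reduced by \<open>m\<close> is at most
      \<open>2 k - 1 < h + 1 - k\<close>.\<close>
    show "(r + s) mod int m \<notin> R"
    proof (cases "r + s < int m")
      case True
      then show ?thesis using red[of "r + s" 0] r s kh by (auto simp: R_def h)
    next
      case False
      then show ?thesis using red[of "r + s" "- 1"] r s kh by (auto simp: R_def h)
    qed
  qed
  moreover have "card R = 2 * k" by (simp add: R_def)
  ultimately show ?thesis by simp
qed

section \<open>The exponent, its prime divisors and the involutions\<close>

lemma group_exponent_dvd_order: "group_exponent G dvd order G"
  by (rule group_exponent_eq_ord) (metis ord_dvd_group_order)

lemma pow_group_exponent: "x \<in> carrier G \<Longrightarrow> x [^] group_exponent G = \<one>"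
  by (rule group_exponent_eq_ord) (simp add: pow_eq_id)

text \<open>Sylow's theorem for the first power of \<open>p\<close> gives a subgroup of order
  \<open>p\<close>; each of its nontrivial elements has order \<open>p\<close>.\<close>

lemma prime_dvd_group_exponent:
  assumes p: "Factorial_Ring.prime p" "p dvd order G"
  shows "p dvd group_exponent G"
proof -
  obtain m where m: "order G = p ^ 1 * m" using p(2) by auto
  obtain H where H: "subgroup H G" "card H = p"
    using sylow_thm[OF p(1) is_group m finite_carrier] by auto
  then have "H \<noteq> {\<one>}" using prime_gt_1_nat[OF p(1)] by auto
  then obtain y where y: "y \<in> H" "y \<noteq> \<one>" using subgroup.one_closed[OF H(1)] by blast
  have yc: "y \<in> carrier G" using y subgroup.subset[OF H(1)] by blast
  interpret H: group "G\<lparr>carrier := H\<rparr>" using H(1) subgroup_imp_group by blast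
  have "y [^]\<^bsub>G\<lparr>carrier := H\<rparr>\<^esub> order (G\<lparr>carrier := H\<rparr>) = \<one>"
    using H.pow_order_eq_1[of y] y by simp
  then have "y [^] p = \<one>" using H(2) by (simp add: order_def flip: nat_pow_consistent)
  then have "ord y dvd p" using yc by (simp add: pow_eq_id)
  then have "ord y = p" using p(1) y(2) yc ord_eq_1 by (metis prime_nat_iff)
  then show ?thesis using yc by (metis group_exponent_eq_ord)
qed

lemma Ord_2_eq: "Ord G 2 = {x \<in> carrier G. x \<otimes> x = \<one>}"
proof -
  have "0 < ord x \<and> ord x \<le> 2 \<longleftrightarrow> x \<otimes> x = \<one>" if x: "x \<in> carrier G" for x
  proof -
    have "x \<otimes> x = \<one> \<longleftrightarrow> ord x dvd 2"
      using pow_eq_id[OF x, of 2] x by (simp add: numeral_2_eq_2)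
    moreover have "0 < ord x" using ord_ge_1[OF finite_carrier x] by simp
    moreover have "d dvd 2 \<longleftrightarrow> d \<le> 2" if "0 < d" for d :: nat
      using that by (auto simp: le_Suc_eq numeral_2_eq_2 dest: dvd_imp_le)
    ultimately show ?thesis by simp
  qed
  then show ?thesis by (auto simp: Ord_def)
qed

section \<open>Evaluation for even exponent\<close>

lemma independence_size_3_le_half: "4 * independence_size G 3 \<le> order G"
proof -
  obtain S where "symmetric_sum_free S" "card S = 2 * independence_size G 3"
    using independence_size_3_obtain by blast
  then show ?thesis using sum_free_card_le_half[of S] by simp
qed

theorem independence_size_3_exponent_0_mod_4:
  assumes "4 dvd group_exponent G"
  shows "4 * independence_size G 3 = order G"
proof -
  have "card {1, 3 :: int} * order G \<le> 2 * independence_size G 3 * 4"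
    by (rule independence_size_ge_preimage) (use assms in auto)
  then show ?thesis using independence_size_3_le_half by simp
qed

theorem independence_size_3_exponent_2_mod_4:
  assumes even: "even (group_exponent G)" and n4: "\<not> 4 dvd group_exponent G"
  shows "4 * independence_size G 3 + card (Ord G 2) = order G"
proof -
  obtain m where m: "group_exponent G = 2 * m" using even by blast
  have odd: "odd m" using n4 m by auto
  define T where "T = {x \<in> carrier G. x \<otimes> x = \<one>}"
  have T: "Ord G 2 = T" by (simp add: T_def Ord_2_eq)
  have finT: "finite T" unfolding T_def by (rule finite_subset_carrier) auto
  obtain S where S: "symmetric_sum_free S" "card S = 2 * independence_size G 3"
    using independence_size_3_obtain by blast
  have "2 * card S + card T \<le> order G"
    unfolding T_def by (rule sum_free_card_le_exponent_2_odd[OF S(1) odd])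
      (use pow_group_exponent m in auto)
  then have upper: "4 * independence_size G 3 + card T \<le> order G" using S(2) by simp
  obtain f g where "character_on (carrier G) (group_exponent G) f" and g: "g \<in> carrier G"
    "[f g = 1] (mod int (group_exponent G))"
    using exists_surjective_character by blast
  then have f: "character_on (carrier G) 2 f" "[f g = 1] (mod int 2)"
    using even by (auto intro: character_on_dvd cong_dvd_modulus)
  define U where "U = {x \<in> carrier G. f x mod int 2 \<in> {1}}"
  have fib: "card U * 2 = order G"
    using card_character_fibers[OF f(1) g(1) f(2), of "{1}"] by (simp add: U_def)
  have finU: "finite U" unfolding U_def by (rule finite_subset_carrier) auto
  have "symmetric_sum_free (U - T)"
  proof (rule symmetric_sum_free_preimage[OF f(1), of "{1}"])
    fix x assume x: "x \<in> U - T"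
    then have xc: "x \<in> carrier G" by (auto simp: U_def)
    have "x \<otimes> x \<noteq> \<one>" using x xc by (simp add: T_def)
    then show "inv x \<noteq> x" using r_inv[OF xc] by metis
    have "inv x \<otimes> inv x = \<one> \<longleftrightarrow> x \<otimes> x = \<one>" using xc by (metis inv_inv inv_mult_group inv_one m_closed)
    moreover have "inv x \<in> U" using x xc character_inv[OF f(1) xc] by (auto simp: U_def)
    ultimately show "inv x \<in> U - T" using x xc by (auto simp: T_def)
  qed (auto simp: U_def)
  then have "card (U - T) \<le> 2 * independence_size G 3" by (rule card_symmetric_sum_free_le)
  \<comment> \<open>The element \<open>z = g [^] m\<close> has square \<open>\<one>\<close> and odd
    value, so multiplication by it moves \<open>U \<inter> T\<close> into \<open>T - U\<close>. As
    \<open>U\<close> is half of \<open>G\<close>, what remains of it is large enough.\<close>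
  moreover have "2 * card (U \<inter> T) \<le> card T"
  proof -
    define z where "z = g [^] m"
    have zc: "z \<in> carrier G" using g by (simp add: z_def)
    have zz: "z \<otimes> z = \<one>" using pow_group_exponent[OF g(1)] g(1) by (simp add: z_def m nat_pow_mult mult_2)
    have "[f z = int m * f g] (mod int 2)"
      unfolding z_def using character_on_pow[OF subgroup_self f(1) g(1)] .
    also have "[int m * f g = int m * 1] (mod int 2)" using f(2) by (rule cong_mult[OF cong_refl])
    finally have fz: "odd (f z)" using odd by (auto simp: cong_def)
    have "card (U \<inter> T) \<le> card (T - U)"
    proof (rule card_translate_le[OF zc])
      fix x assume x: "x \<in> U \<inter> T"
      then have xc: "x \<in> carrier G" and xx: "x \<otimes> x = \<one>" and fx: "odd (f x)"
        by (auto simp: U_def T_def odd_iff_mod_2_eq_one)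
      have "[f (z \<otimes> x) = f z + f x] (mod int 2)" using character_onD[OF f(1) zc xc] .
      then have "f (z \<otimes> x) mod 2 = (f z + f x) mod 2" by (simp add: cong_def)
      then have "even (f (z \<otimes> x))" using fz fx by presburger
      moreover have "(z \<otimes> x) \<otimes> (z \<otimes> x) = (z \<otimes> z) \<otimes> (x \<otimes> x)" using zc xc by (simp add: m_ac)
      ultimately show "z \<otimes> x \<in> T - U" using zc xc zz xx by (auto simp: T_def U_def)
    qed (auto simp: T_def)
    moreover have "card T = card (T \<inter> U) + card (T - U)" by (rule card_Int_Diff[OF finT])
    ultimately show ?thesis by (simp add: Int_commute)
  qed
  moreover have "card U = card (U \<inter> T) + card (U - T)" by (rule card_Int_Diff[OF finU])
  ultimately show ?thesis using upper fib unfolding T by linarith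
qed

section \<open>Evaluation for odd order\<close>

lemma independence_size_3_le_third:
  assumes "independence_size G 3 \<noteq> 0"
  obtains m q where "m dvd order G" "3 * q \<le> m + 1" "2 * independence_size G 3 * m \<le> order G * q"
proof -
  obtain S where S: "symmetric_sum_free S" "card S = 2 * independence_size G 3"
    using independence_size_3_obtain by blast
  then have "S \<noteq> {}" using assms by auto
  then show thesis using sum_free_card_le_third[OF S(1)] S(2) that by auto
qed

text \<open>Equality in \<open>3 * q \<le> m + 1\<close> would need \<open>m mod 3 = 2\<close>,
  hence a prime factor congruent to \<open>5\<close> modulo \<open>6\<close>; so
  \<open>3 * q \<le> m\<close>.\<close>

theorem independence_size_3_le_sixth:
  assumes odd: "odd (order G)"
    and no: "\<not> (\<exists>p. Factorial_Ring.prime p \<and> p dvd order G \<and> [p = 5] (mod 6))"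
  shows "6 * independence_size G 3 \<le> order G"
proof (cases "independence_size G 3 = 0")
  case False
  then obtain m q where mq: "m dvd order G" "3 * q \<le> m + 1" "2 * independence_size G 3 * m \<le> order G * q"
    by (rule independence_size_3_le_third)
  have "odd m" using odd mq(1) dvd_trans by blast
  then have "m mod 3 \<noteq> 2" using exists_prime_factor_5_mod_6[of m] no mq(1) dvd_trans by blast
  then have "3 * q \<le> m" using mq(2) by presburger
  then have "order G * (3 * q) \<le> order G * m" by (rule mult_le_mono2)
  then have "6 * independence_size G 3 * m \<le> order G * m" using mq(3) by linarith
  moreover have "m > 0" using \<open>odd m\<close> by (cases m) auto
  ultimately show ?thesis by simp
qed simp

theorem independence_size_3_prime_5_mod_6:
  assumes odd: "odd (order G)" and p: "Factorial_Ring.prime p" "p dvd order G" "[p = 5] (mod 6)"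
    and least: "\<And>q. Factorial_Ring.prime q \<Longrightarrow> q dvd order G \<Longrightarrow> [q = 5] (mod 6) \<Longrightarrow> p \<le> q"
  shows "6 * independence_size G 3 * p = (p + 1) * order G"
proof (rule antisym)
  have pp: "p mod 6 = 5" using p(3) by (simp add: cong_def)
  then have "odd p" by presburger
  define k where "k = (p + 1) div 6"
  have k: "6 * k = p + 1" using pp unfolding k_def by presburger
  have "k * order G \<le> independence_size G 3 * p"
    using independence_size_ge_middle_third[OF prime_dvd_group_exponent[OF p(1,2)] \<open>odd p\<close>] k by simp
  then have "6 * (k * order G) \<le> 6 * (independence_size G 3 * p)" by (rule mult_le_mono2)
  then show "(p + 1) * order G \<le> 6 * independence_size G 3 * p"
    unfolding k[symmetric] by (simp add: mult.assoc)
  show "6 * independence_size G 3 * p \<le> (p + 1) * order G"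
  proof (cases "independence_size G 3 = 0")
    case False
    define s where "s = independence_size G 3"
    define n where "n = order G"
    obtain m q where mq: "m dvd n" "3 * q \<le> m + 1" "2 * s * m \<le> n * q"
      using independence_size_3_le_third[OF False] unfolding s_def n_def .
    have "odd m" using odd mq(1) dvd_trans unfolding n_def by blast
    then have mpos: "m > 0" by (cases m) auto
    \<comment> \<open>That is, \<open>3 q / m \<le> 1 + 1 / p\<close>. Only
      \<open>m mod 3 = 2\<close> is critical; then a prime factor congruent to \<open>5\<close>
      modulo \<open>6\<close> and the minimality of \<open>p\<close> give \<open>p \<le> m\<close>,
      so \<open>1 + 1 / m \<le> 1 + 1 / p\<close>.\<close>
    have "(3 * q) * p \<le> (p + 1) * m"
    proof (cases "m mod 3 = 2")
      case True
      then obtain r where "Factorial_Ring.prime r" "r dvd m" "[r = 5] (mod 6)"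
        using exists_prime_factor_5_mod_6 \<open>odd m\<close> by blast
      then have "p \<le> m" using least mq(1) mpos unfolding n_def by (meson dvd_imp_le dvd_trans le_trans)
      then have "(m + 1) * p \<le> (p + 1) * m" by simp
      then show ?thesis using mult_le_mono1[OF mq(2), of p] by linarith
    next
      case False
      then have "3 * q \<le> m" using mq(2) by presburger
      then have "(3 * q) * p \<le> m * p" by (rule mult_le_mono1)
      also have "\<dots> \<le> (p + 1) * m" by simp
      finally show ?thesis .
    qed
    then have "n * ((3 * q) * p) \<le> n * ((p + 1) * m)" by (rule mult_le_mono2)
    have "(6 * s * p) * m = (2 * s * m) * (3 * p)" by simp
    also have "\<dots> \<le> (n * q) * (3 * p)" using mq(3) by (rule mult_le_mono1)
    also have "\<dots> = n * ((3 * q) * p)" by simp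
    also have "\<dots> \<le> n * ((p + 1) * m)" by fact
    also have "\<dots> = ((p + 1) * n) * m" by (simp only: mult_ac)
    finally have "(6 * s * p) * m \<le> ((p + 1) * n) * m" .
    then show ?thesis using mpos unfolding s_def n_def by simp
  qed simp
qed

end

section \<open>The four cases as statements about real numbers\<close>

theorem theorem12:
  fixes G :: "('a, 'b) monoid_scheme" and n \<kappa> :: nat
  assumes "comm_group G"
    and "finite (carrier G)"
    and "n = order G"
    and "n \<ge> 2"
    and "\<kappa> = group_exponent G"
  shows
    "(4 dvd \<kappa> \<longrightarrow>
        real (independence_size G 3) = real n / 4) \<and>
     (even \<kappa> \<and> \<not> 4 dvd \<kappa> \<longrightarrow>
        real (independence_size G 3) = 1 / 4 * (real n - real (card (Ord G 2)))) \<and>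
     (\<forall>p::nat. odd n \<and> Factorial_Ring.prime p \<and> p dvd n \<and> [p = 5] (mod 6) \<and>
        (\<forall>q::nat. Factorial_Ring.prime q \<and> q dvd n \<and> [q = 5] (mod 6) \<longrightarrow> p \<le> q) \<longrightarrow>
        real (independence_size G 3) = (1 + 1 / real p) * (real n / 6)) \<and>
     (odd n \<and> \<not> (\<exists>p::nat. Factorial_Ring.prime p \<and> p dvd n \<and> [p = 5] (mod 6)) \<longrightarrow>
        of_int \<lfloor>real \<kappa> / 6\<rfloor> * (real n / real \<kappa>) \<le> real (independence_size G 3) \<and>
        real (independence_size G 3) \<le> real n / 6)"
proof -
  interpret finite_comm_group G
    using assms(1,2) by (simp add: finite_comm_group_def finite_comm_group_axioms_def)
  define s where "s = independence_size G 3"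
  show ?thesis
    unfolding s_def[symmetric]
  proof (intro conjI allI impI)
    assume "4 dvd \<kappa>"
    then have "4 * s = n"
      using independence_size_3_exponent_0_mod_4 assms(3,5) by (simp add: s_def)
    then show "real s = real n / 4" by (simp flip: of_nat_mult)
  next
    assume "even \<kappa> \<and> \<not> 4 dvd \<kappa>"
    then have "4 * s + card (Ord G 2) = n"
      using independence_size_3_exponent_2_mod_4 assms(3,5) by (simp add: s_def)
    then have "4 * real s + real (card (Ord G 2)) = real n" by linarith
    then show "real s = 1 / 4 * (real n - real (card (Ord G 2)))" by simp
  next
    fix p :: nat
    assume p: "odd n \<and> Factorial_Ring.prime p \<and> p dvd n \<and> [p = 5] (mod 6) \<and>
        (\<forall>q::nat. Factorial_Ring.prime q \<and> q dvd n \<and> [q = 5] (mod 6) \<longrightarrow> p \<le> q)"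
    then have "6 * s * p = (p + 1) * n"
      using independence_size_3_prime_5_mod_6[of p] assms(3) by (simp add: s_def)
    then have "real (6 * s * p) = real ((p + 1) * n)" by (rule arg_cong)
    moreover have "p > 0" using p prime_gt_0_nat by blast
    ultimately show "real s = (1 + 1 / real p) * (real n / 6)" by (simp add: field_simps)
  next
    assume "odd n \<and> \<not> (\<exists>p::nat. Factorial_Ring.prime p \<and> p dvd n \<and> [p = 5] (mod 6))"
    then have "6 * s \<le> n"
      using independence_size_3_le_sixth assms(3) by (simp add: s_def)
    then have "6 * real s \<le> real n" by linarith
    then show "real s \<le> real n / 6" by simp
  next
    assume "odd n \<and> \<not> (\<exists>p::nat. Factorial_Ring.prime p \<and> p dvd n \<and> [p = 5] (mod 6))"
    then have odd: "odd \<kappa>"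
      using group_exponent_dvd_order assms(3,5) dvd_trans by blast
    \<comment> \<open>Here the middle third is taken among the residues modulo the full
      exponent.\<close>
    have "(\<kappa> div 6) * n \<le> s * \<kappa>"
      using independence_size_ge_middle_third[of \<kappa> "\<kappa> div 6"] odd assms(3,5) by (simp add: s_def)
    then have "real (\<kappa> div 6) * real n \<le> real s * real \<kappa>" by (simp flip: of_nat_mult)
    moreover have "\<lfloor>real \<kappa> / 6\<rfloor> = int (\<kappa> div 6)"
      using floor_divide_of_nat_eq[of \<kappa> 6] by simp
    moreover have "\<kappa> > 0" using odd by (cases \<kappa>) auto
    ultimately show "of_int \<lfloor>real \<kappa> / 6\<rfloor> * (real n / real \<kappa>) \<le> real s"
      by (simp add: field_simps)
  qed
qed

end
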